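(* Consider a rank-one Rician fading MIMO channel with a fixed total number of antennas $n_T+n_R=N$, where $N\ge2$. Fix the Rician factor $K>0$, the noise level $\sigma_n>0$, the transmit power $\Omega_D>0$ and the SNR threshold $\mu_{\min}>0$. Then for all sufficiently small $\sigma_H>0$, among all pairs of positive integers $(n_T,n_R)$ with $n_T+n_R=N$, the outage probability $P_{\text{out}}$ is minimized by $n_T=n_R=N/2$ if $N$ is even, and by $n_T=\lfloor N/2\rfloor$, $n_R=\lceil N/2\rceil$ if $N$ is odd.
   Context: The channel has $n_T$ transmitting and $n_R$ receiving antennas. Its random $n_R\times n_T$ channel matrix is $$H=\sqrt{\tfrac{K}{K+1}}\,H_1+\sqrt{\tfrac{1}{K+1}}\,H_2,$$ where $H_1=\mathbf u\mathbf v^\dagger$ is a deterministic rank-one matrix, $\mathbf u\in\mathbb C^{n_R}$, $\mathbf v\in\mathbb C^{n_T}$, normalized so that $\operatorname{tr}(H_1H_1^\dagger)=\|\mathbf u\|^2\|\mathbf v\|^2=n_Rn_T$, and $H_2$ has i.i.d. circularly symmetric complex Gaussian entries with mean $0$ and variance $\mathbb E|(H_2)_{ij}|^2=\sigma_H^2$. Here $\dagger$ denotes conjugate transpose. The signal-to-noise ratio of the channel is $\mu=\frac{\Omega_D}{\sigma_n^2}\lambda_{\max}$, where $\lambda_{\max}$ is the largest eigenvalue of $HH^\dagger$, and the outage probability is $$P_{\text{out}}=\Pr\left(\frac{\Omega_D}{\sigma_n^2}\lambda_{\max}\le\mu_{\min}\right).$$ *)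

theory Defs
  imports "HOL-Probability.Probability" "Jordan_Normal_Form.Schur_Decomposition"
begin

unbundle no vec_syntax

(* Circularly symmetric complex Gaussian law with mean 0 and E |Z|^2 = s^2: the real and
   imaginary parts are independent, each with variance s^2 / 2. *)
definition cscg :: "real \<Rightarrow> complex measure" where
  "cscg s =
     distr (density lborel (normal_density 0 (s / sqrt 2)) \<Otimes>\<^sub>M
            density lborel (normal_density 0 (s / sqrt 2)))
       borel (\<lambda>(x, y). Complex x y)"

(* Joint law of the entries of an nR x nT matrix with i.i.d. entries; it serves as the sample
   space, on which the random matrix is "mat nR nT". *)
definition cscg_entries :: "nat \<Rightarrow> nat \<Rightarrow> real \<Rightarrow> (nat \<times> nat \<Rightarrow> complex) measure" where
  "cscg_entries nR nT s = (\<Pi>\<^sub>M ij \<in> {..<nR} \<times> {..<nT}. cscg s)"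

definition mat_trace :: "complex mat \<Rightarrow> complex" where
  "mat_trace A = (\<Sum>i<dim_row A. A $$ (i, i))"

(* The matrix u v^dagger. *)
definition rank_one_mat :: "complex vec \<Rightarrow> complex vec \<Rightarrow> complex mat" where
  "rank_one_mat u v = mat (dim_vec u) (dim_vec v) (\<lambda>(i, j). u $ i * cnj (v $ j))"

definition normalized_pair :: "nat \<Rightarrow> nat \<Rightarrow> complex vec \<Rightarrow> complex vec \<Rightarrow> bool" where
  "normalized_pair nT nR u v \<longleftrightarrow>
     u \<in> carrier_vec nR \<and> v \<in> carrier_vec nT \<and>
     mat_trace (rank_one_mat u v * mat_adjoint (rank_one_mat u v)) = of_nat (nR * nT)"

definition rician_mat :: "real \<Rightarrow> complex mat \<Rightarrow> complex mat \<Rightarrow> complex mat" where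
  "rician_mat K H1 H2 =
     complex_of_real (sqrt (K / (K + 1))) \<cdot>\<^sub>m H1 + complex_of_real (sqrt (1 / (K + 1))) \<cdot>\<^sub>m H2"

(* Used for Hermitian matrices only, all of whose eigenvalues are real. *)
definition max_eigenvalue :: "complex mat \<Rightarrow> real" where
  "max_eigenvalue A = Max {x. eigenvalue A (complex_of_real x)}"

definition snr :: "real \<Rightarrow> real \<Rightarrow> complex mat \<Rightarrow> real" where
  "snr \<Omega>D \<sigma>n H = \<Omega>D / \<sigma>n\<^sup>2 * max_eigenvalue (H * mat_adjoint H)"

definition P_out ::
  "real \<Rightarrow> real \<Rightarrow> real \<Rightarrow> real \<Rightarrow> real \<Rightarrow> nat \<Rightarrow> nat \<Rightarrow> complex vec \<Rightarrow> complex vec \<Rightarrow> real"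
where
  "P_out K \<sigma>n \<Omega>D \<mu>min \<sigma>H nT nR u v =
     \<P>(\<omega> in cscg_entries nR nT \<sigma>H.
        snr \<Omega>D \<sigma>n (rician_mat K (rank_one_mat u v) (mat nR nT \<omega>)) \<le> \<mu>min)"

end

(* The law of the noise matrix H_2 is invariant under H_2 -> U H_2 V with U, V unitary.
   The outage event says that the operator norm of H is at most a threshold, so invariance replaces
   the rank-one mean by c * E_00 with c proportional to sqrt (nR * nT), and the outage probability
   depends on the product nR * nT only (with nR and nT exchangeable, by transposition).
   For sigma_H -> 0 the law of H_2 satisfies a large deviation principle with rate the squared
   Frobenius norm, and the distance from c * E_00 to the boundary of the ball of radius r in operator
   norm is |c - r|. If c > r, outage is the rare event and gets rarer with c; if c <= r,
   non-outage is the rare event and gets likelier with c. Hence the pair with the larger product wins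
   for small sigma_H, and the product is largest at the balanced pair. *)

theory Submission
  imports Defs
    "Jordan_Normal_Form.Spectral_Radius"
    "Jordan_Normal_Form.Jordan_Normal_Form_Existence"
    "HOL-Real_Asymp.Real_Asymp"
begin

section \<open>The largest eigenvalue as an operator norm\<close>

text \<open>The operator norm is expressed by \<open>bilinear_bound\<close> on plain index
  functions: the test vectors absorb rotations and transposition of the matrix, and for fixed
  \<open>x\<close> and \<open>y\<close> the condition is closed in the entries. Instead of general
  unitary \<open>U\<close> and \<open>V\<close>, products of rotations of two coordinates are used,
  so the invariance of the Gaussian law has to be checked only for one such rotation and for a
  common phase. After division by the weight of the noise, the radius \<open>r\<close> is the same
  for all antenna pairs and only the size sqrt (K * nR * nT) of the mean varies. Precise asymptotics
  are avoided: as \<open>c < c'\<close> strictly, some \<open>Q\<close> fits strictly between the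
  two costs, and exp (- Q / s^2) separates the two probabilities for small \<open>s\<close>; factors
  that depend on the dimensions are absorbed in the slack. Equal products cannot be compared in this
  way and are settled by the exact symmetry under transposition. For given \<open>N\<close> only
  finitely many pairs occur, hence there is a common threshold for the noise level, and it does not
  depend on \<open>u\<close> and \<open>v\<close>.\<close>

definition bilinear_bound ::
  "nat \<Rightarrow> nat \<Rightarrow> real \<Rightarrow> (nat \<times> nat \<Rightarrow> complex) \<Rightarrow> bool" where
  "bilinear_bound m n r M \<longleftrightarrow>
     (\<forall>x y. cmod (\<Sum>i<m. \<Sum>j<n. x i * M (i, j) * y j)
        \<le> r * L2_set (\<lambda>i. cmod (x i)) {..<m} * L2_set (\<lambda>j. cmod (y j)) {..<n})"

lemma norm_sum_mult_le_L2_set: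
  fixes f g :: "'a \<Rightarrow> complex"
  shows "cmod (\<Sum>i\<in>I. f i * g i) \<le> L2_set (\<lambda>i. cmod (f i)) I * L2_set (\<lambda>i. cmod (g i)) I"
proof -
  have "cmod (\<Sum>i\<in>I. f i * g i) \<le> (\<Sum>i\<in>I. \<bar>cmod (f i)\<bar> * \<bar>cmod (g i)\<bar>)"
    by (rule order_trans[OF norm_sum]) (simp add: norm_mult)
  also have "\<dots> \<le> L2_set (\<lambda>i. cmod (f i)) I * L2_set (\<lambda>i. cmod (g i)) I"
    by (rule L2_set_mult_ineq)
  finally show ?thesis .
qed

lemma cscalar_prod_self:
  fixes w :: "complex vec"
  shows "w \<bullet>c w = complex_of_real ((L2_set (\<lambda>i. cmod (w $ i)) {..<dim_vec w})\<^sup>2)"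
  by (auto simp: scalar_prod_def L2_set_def sum_nonneg complex_norm_square atLeast0LessThan
      simp flip: of_real_power)

lemma cscalar_prod_bound:
  fixes v w :: "complex vec"
  assumes "dim_vec v = n" "dim_vec w = n"
  shows "cmod (v \<bullet>c w) \<le> L2_set (\<lambda>i. cmod (v $ i)) {..<n} * L2_set (\<lambda>i. cmod (w $ i)) {..<n}"
proof -
  have "v \<bullet>c w = (\<Sum>i\<in>{..<n}. v $ i * cnj (w $ i))"
    using assms by (simp add: scalar_prod_def atLeast0LessThan)
  then show ?thesis
    using norm_sum_mult_le_L2_set[of "\<lambda>i. v $ i" "\<lambda>i. cnj (w $ i)" "{..<n}"] by simp
qed

section \<open>Adjoints, and quadratic forms of Hermitian matrices\<close>

lemma mat_adjoint_index [simp]: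
  assumes "i < dim_col A" "j < dim_row A"
  shows "mat_adjoint A $$ (i, j) = conjugate (A $$ (j, i))"
  using assms by (simp add: mat_adjoint_def mat_of_rows_def)

lemma mat_adjoint_dim [simp]:
  "dim_row (mat_adjoint A) = dim_col A" "dim_col (mat_adjoint A) = dim_row A"
  by (simp_all add: mat_adjoint_def)

lemma mult_mat_vec_cscalar_prod:
  fixes A :: "complex mat"
  assumes "A \<in> carrier_mat m n" "x \<in> carrier_vec n" "y \<in> carrier_vec m"
  shows "(A *\<^sub>v x) \<bullet>c y = x \<bullet>c (mat_adjoint A *\<^sub>v y)"
proof -
  have "(A *\<^sub>v x) \<bullet>c y = (\<Sum>i<m. (\<Sum>j<n. A $$ (i, j) * x $ j) * cnj (y $ i))"
    using assms by (auto simp: scalar_prod_def atLeast0LessThan)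
  also have "\<dots> = (\<Sum>j<n. \<Sum>i<m. A $$ (i, j) * x $ j * cnj (y $ i))"
    by (subst sum.swap) (simp add: sum_distrib_right)
  also have "\<dots> = x \<bullet>c (mat_adjoint A *\<^sub>v y)"
    using assms by (auto simp: scalar_prod_def atLeast0LessThan sum_distrib_left mult_ac intro!: sum.cong)
  finally show ?thesis .
qed

lemma pow_mat_add:
  assumes "H \<in> carrier_mat n n"
  shows "H ^\<^sub>m (j + k) = H ^\<^sub>m j * H ^\<^sub>m k"
  using assms
  by (induction k) (auto simp: assoc_mult_mat[of "H ^\<^sub>m j" n n _ n _ n])

lemma hermitian_pow_cscalar_prod:
  fixes H :: "complex mat"
  assumes H: "H \<in> carrier_mat n n" and herm: "mat_adjoint H = H"
    and x: "x \<in> carrier_vec n" and y: "y \<in> carrier_vec n"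
  shows "(H ^\<^sub>m k *\<^sub>v x) \<bullet>c y = x \<bullet>c (H ^\<^sub>m k *\<^sub>v y)"
  using x y
proof (induction k arbitrary: x y)
  case 0
  then show ?case using H by simp
next
  case (Suc k)
  have Hk: "H ^\<^sub>m k \<in> carrier_mat n n" using H by (rule pow_carrier_mat)
  have "(H ^\<^sub>m Suc k *\<^sub>v x) \<bullet>c y = (H ^\<^sub>m k *\<^sub>v (H *\<^sub>v x)) \<bullet>c y"
    using Suc.prems H Hk by (simp add: assoc_mult_mat_vec[of _ n n])
  also have "\<dots> = (H *\<^sub>v x) \<bullet>c (H ^\<^sub>m k *\<^sub>v y)"
    using Suc.prems H by (intro Suc.IH) auto
  also have "\<dots> = x \<bullet>c (H *\<^sub>v (H ^\<^sub>m k *\<^sub>v y))"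
    using mult_mat_vec_cscalar_prod[OF H Suc.prems(1) mult_mat_vec_carrier[OF Hk Suc.prems(2)]] herm
    by simp
  also have "H *\<^sub>v (H ^\<^sub>m k *\<^sub>v y) = H ^\<^sub>m Suc k *\<^sub>v y"
    using pow_mat_add[OF H, of 1 k] assoc_mult_mat_vec[OF H Hk Suc.prems(2)] H
    by simp
  finally show ?case .
qed

text \<open>Repeated squaring: for a unit vector \<open>w\<close>, Cauchy-Schwarz and
  self-adjointness give |<H^j w, w>|^2 \<le> |H^j w|^2 = <H^(2j) w, w>, so each doubling of the
  exponent squares the bound.\<close>

lemma hermitian_cscalar_prod_power2_le:
  fixes H :: "complex mat"
  assumes H: "H \<in> carrier_mat n n" and herm: "mat_adjoint H = H"
    and w: "w \<in> carrier_vec n" "L2_set (\<lambda>i. cmod (w $ i)) {..<n} = 1"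
  shows "cmod ((H *\<^sub>v w) \<bullet>c w) ^ (2 ^ k) \<le> cmod ((H ^\<^sub>m (2 ^ k) *\<^sub>v w) \<bullet>c w)"
proof (induction k)
  case 0
  then show ?case using H by simp
next
  case (Suc k)
  let ?j = "2 ^ k :: nat"
  let ?v = "H ^\<^sub>m ?j *\<^sub>v w"
  have Hj: "H ^\<^sub>m ?j \<in> carrier_mat n n" using H by (rule pow_carrier_mat)
  then have v: "?v \<in> carrier_vec n" using w(1) by (rule mult_mat_vec_carrier)
  have "cmod ((H *\<^sub>v w) \<bullet>c w) ^ (2 ^ Suc k) = (cmod ((H *\<^sub>v w) \<bullet>c w) ^ ?j)\<^sup>2"
    by (simp add: mult.commute flip: power_mult)
  also have "\<dots> \<le> (cmod (?v \<bullet>c w))\<^sup>2"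
    by (intro power_mono Suc.IH) auto
  also have "\<dots> \<le> (L2_set (\<lambda>i. cmod (?v $ i)) {..<n})\<^sup>2"
    using cscalar_prod_bound[of ?v n w] v w(2) carrier_vecD[OF v] carrier_vecD[OF w(1)]
    by (intro power_mono) auto
  also have "\<dots> = cmod (?v \<bullet>c ?v)"
    using cscalar_prod_self[of ?v] carrier_vecD[OF v] by (metis norm_of_real abs_power2 norm_power)
  also have "?v \<bullet>c ?v = (H ^\<^sub>m ?j *\<^sub>v ?v) \<bullet>c w"
    using hermitian_pow_cscalar_prod[OF H herm v w(1)] by simp
  also have "H ^\<^sub>m ?j *\<^sub>v ?v = H ^\<^sub>m (2 ^ Suc k) *\<^sub>v w"
    using pow_mat_add[OF H, of ?j ?j] Hj w by (simp add: mult_2)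
  finally show ?case .
qed

lemma power_two_bounded_imp_le_1:
  fixes x :: real
  assumes "\<And>k. x ^ (2 ^ k) \<le> C"
  shows "x \<le> 1"
proof (rule ccontr)
  assume "\<not> x \<le> 1"
  then obtain n where "C < x ^ n" using real_arch_pow[of x C] by auto
  also have "\<dots> \<le> x ^ (2 ^ n)"
    using \<open>\<not> x \<le> 1\<close> by (intro power_increasing) (auto simp: less_imp_le)
  finally show False using assms[of n] by simp
qed

text \<open>The powers of a matrix of spectral radius below 1 are bounded; for Hermitian matrices
  \<open>\<bar>\<langle>H w, w\<rangle>\<bar>\<close> to the power \<open>2 ^ k\<close> is at most \<open>\<bar>\<langle>H ^ (2 ^ k) w, w\<rangle>\<bar>\<close>, which then rules out
  \<open>\<bar>\<langle>H w, w\<rangle>\<bar> > 1\<close>.\<close>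

lemma hermitian_cscalar_prod_le_1:
  fixes H :: "complex mat"
  assumes H: "H \<in> carrier_mat n n" and herm: "mat_adjoint H = H" and rad: "spectral_radius H < 1"
    and w: "w \<in> carrier_vec n" "L2_set (\<lambda>i. cmod (w $ i)) {..<n} = 1"
  shows "cmod ((H *\<^sub>v w) \<bullet>c w) \<le> 1"
proof -
  obtain as where "char_poly H = (\<Prod>a\<leftarrow>as. [:- a, 1:])"
    using char_poly_factorized[OF H] by auto
  \<comment> \<open>One constant bounds the entries of all powers; it may be large, but it does not
    depend on \<open>k\<close>, which is all that the repeated squaring needs.\<close>
  from spectral_radius_jnf_norm_bound_less_1[OF H rad jordan_nf_exists[OF H this]]
  obtain c where c: "\<And>k. norm_bound (H ^\<^sub>m k) c" by auto
  have "cmod ((H ^\<^sub>m k *\<^sub>v w) \<bullet>c w) \<le> (\<Sum>i<n. \<Sum>j<n. c)" for k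
  proof -
    have le1: "cmod (w $ i) \<le> 1" if "i < n" for i
      using member_le_L2_set[of "{..<n}" i "\<lambda>i. cmod (w $ i)"] that w by simp
    have Hk: "H ^\<^sub>m k \<in> carrier_mat n n" using H by (rule pow_carrier_mat)
    have c0: "cmod ((H ^\<^sub>m k) $$ (i, j)) \<le> c" if "i < n" "j < n" for i j
      using c[of k] carrier_matD[OF Hk] that unfolding norm_bound_def by metis
    have "cmod ((H ^\<^sub>m k *\<^sub>v w) \<bullet>c w) \<le> (\<Sum>i<n. \<Sum>j<n. cmod ((H ^\<^sub>m k) $$ (i, j) * w $ j * cnj (w $ i)))"
    proof -
      have "(H ^\<^sub>m k *\<^sub>v w) \<bullet>c w = (\<Sum>i<n. \<Sum>j<n. (H ^\<^sub>m k) $$ (i, j) * w $ j * cnj (w $ i))"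
        using carrier_matD[OF Hk] carrier_vecD[OF w(1)]
        by (simp add: scalar_prod_def atLeast0LessThan sum_distrib_right del: pow_mat_dim)
      then show ?thesis by (simp only:) (intro order_trans[OF norm_sum] sum_mono order_refl)
    qed
    also have "\<dots> \<le> (\<Sum>i<n. \<Sum>j<n. c)"
    proof (intro sum_mono)
      fix i j assume ij: "i \<in> {..<n}" "j \<in> {..<n}"
      have "cmod ((H ^\<^sub>m k) $$ (i, j)) * cmod (w $ j) * cmod (w $ i) \<le> c * 1 * 1"
        using ij le1 c0 order_trans[OF norm_ge_zero c0[of i j]] by (intro mult_mono) auto
      then show "cmod ((H ^\<^sub>m k) $$ (i, j) * w $ j * cnj (w $ i)) \<le> c"
        by (simp add: norm_mult)
    qed
    finally show ?thesis .
  qed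
  with hermitian_cscalar_prod_power2_le[OF H herm w] show ?thesis
    by (intro power_two_bounded_imp_le_1) (rule order_trans)
qed

lemma eigenvalue_smult_mat:
  fixes H :: "complex mat"
  assumes H: "H \<in> carrier_mat n n" and "eigenvalue (c \<cdot>\<^sub>m H) k" "c \<noteq> 0"
  shows "eigenvalue H (k / c)"
proof -
  obtain v where v: "v \<in> carrier_vec n" "v \<noteq> 0\<^sub>v n" "(c \<cdot>\<^sub>m H) *\<^sub>v v = k \<cdot>\<^sub>v v"
    using assms by (auto simp: eigenvalue_def eigenvector_def)
  have "(c \<cdot>\<^sub>m H) *\<^sub>v v = c \<cdot>\<^sub>v (H *\<^sub>v v)"
    using v(1) H by (intro eq_vecI) (simp_all add: scalar_prod_def sum_distrib_left mult_ac)
  then have "c \<cdot>\<^sub>v (H *\<^sub>v v) = k \<cdot>\<^sub>v v"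
    using v by simp
  then have "inverse c \<cdot>\<^sub>v (c \<cdot>\<^sub>v (H *\<^sub>v v)) = inverse c \<cdot>\<^sub>v (k \<cdot>\<^sub>v v)" by simp
  then have "H *\<^sub>v v = (k / c) \<cdot>\<^sub>v v"
    using assms(3) by (simp add: smult_smult_assoc field_simps)
  then show ?thesis using v H by (auto simp: eigenvalue_def eigenvector_def)
qed

text \<open>For every \<open>t\<close> above the spectral radius, H / t has spectral radius strictly
  below 1, so the preceding bound applies to it and to the normalised vector. Letting
  \<open>t\<close> decrease to the spectral radius removes the strictness.\<close>

lemma hermitian_cscalar_prod_le_spectral_radius:
  fixes H :: "complex mat"
  assumes H: "H \<in> carrier_mat n n" and herm: "mat_adjoint H = H" and n: "n > 0"
    and w: "w \<in> carrier_vec n"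
  shows "cmod ((H *\<^sub>v w) \<bullet>c w) \<le> spectral_radius H * (L2_set (\<lambda>i. cmod (w $ i)) {..<n})\<^sup>2"
proof -
  let ?l = "L2_set (\<lambda>i. cmod (w $ i)) {..<n}"
  have rad0: "0 \<le> spectral_radius H"
    using spectral_radius_mem_max(1)[OF H n] by auto
  show ?thesis
  proof (cases "?l = 0")
    case True
    then have "w $ i = 0" if "i < n" for i
      using that by (subst (asm) L2_set_eq_0_iff) auto
    then have "w = 0\<^sub>v n" using w by (intro eq_vecI) auto
    then have "(H *\<^sub>v w) \<bullet>c w = 0" using H by simp
    then show ?thesis using rad0 by simp
  next
    case False
    then have l: "?l > 0" using L2_set_nonneg[of "\<lambda>i. cmod (w $ i)" "{..<n}"] by linarith
    have "cmod ((H *\<^sub>v w) \<bullet>c w) \<le> t * ?l\<^sup>2" if t: "t > spectral_radius H" for t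
    proof -
      have t0: "t > 0" using t rad0 by simp
      define G where "G = complex_of_real (1 / t) \<cdot>\<^sub>m H"
      define x where "x = complex_of_real (1 / ?l) \<cdot>\<^sub>v w"
      have G: "G \<in> carrier_mat n n" using H by (simp add: G_def)
      have x: "x \<in> carrier_vec n" using w by (simp add: x_def)
      have "mat_adjoint G = G"
      proof (rule eq_matI)
        fix i j assume "i < dim_row G" "j < dim_col G"
        then have ij: "i < n" "j < n" using G by auto
        then have "mat_adjoint H $$ (i, j) = conjugate (H $$ (j, i))" using H by simp
        then show "mat_adjoint G $$ (i, j) = G $$ (i, j)" using ij H herm by (simp add: G_def)
      qed (use H in \<open>auto simp: G_def\<close>)
      moreover have "spectral_radius G < 1"
      proof -
        obtain k where k: "eigenvalue G k" "spectral_radius G = cmod k"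
          using spectral_radius_mem_max(1)[OF G n] by (auto simp: spectrum_def)
        have "eigenvalue H (k / complex_of_real (1 / t))"
          using k(1) H t0 by (intro eigenvalue_smult_mat) (auto simp: G_def)
        then have "cmod (k / complex_of_real (1 / t)) \<le> spectral_radius H"
          by (intro spectral_radius_mem_max(2)[OF H n]) (auto simp: spectrum_def)
        then have "t * cmod k \<le> spectral_radius H" using t0 by (simp add: norm_mult norm_divide field_simps)
        then have "t * cmod k < t * 1" using t by linarith
        then show ?thesis using t0 k(2) by (simp only: mult_less_cancel_left_pos)
      qed
      moreover have "L2_set (\<lambda>i. cmod (x $ i)) {..<n} = 1"
      proof -
        have "L2_set (\<lambda>i. cmod (x $ i)) {..<n} = L2_set (\<lambda>i. 1 / ?l * cmod (w $ i)) {..<n}"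
          using w l by (intro L2_set_cong) (auto simp: x_def norm_mult norm_divide)
        also have "\<dots> = 1 / ?l * ?l"
          using L2_set_right_distrib[of "1 / ?l" "\<lambda>i. cmod (w $ i)" "{..<n}"] l by simp
        finally show ?thesis using l by simp
      qed
      ultimately have "cmod ((G *\<^sub>v x) \<bullet>c x) \<le> 1"
        using hermitian_cscalar_prod_le_1[OF G] x by blast
      moreover have "(G *\<^sub>v x) \<bullet>c x = complex_of_real (1 / t / ?l\<^sup>2) * ((H *\<^sub>v w) \<bullet>c w)"
      proof -
        have "(G *\<^sub>v x) \<bullet>c x = (\<Sum>i<n. \<Sum>j<n. G $$ (i, j) * x $ j * cnj (x $ i))"
          using G x by (auto simp: scalar_prod_def atLeast0LessThan sum_distrib_right)
        also have "\<dots> = complex_of_real (1 / t / ?l\<^sup>2) * (\<Sum>i<n. \<Sum>j<n. H $$ (i, j) * w $ j * cnj (w $ i))"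
          using H w l t0 unfolding sum_distrib_left
          by (intro sum.cong) (auto simp: G_def x_def power2_eq_square field_simps)
        also have "(\<Sum>i<n. \<Sum>j<n. H $$ (i, j) * w $ j * cnj (w $ i)) = (H *\<^sub>v w) \<bullet>c w"
          using H w by (auto simp: scalar_prod_def atLeast0LessThan sum_distrib_right)
        finally show ?thesis .
      qed
      ultimately show ?thesis
        using t0 l by (simp add: norm_mult norm_divide norm_power field_simps)
    qed
    then have "cmod ((H *\<^sub>v w) \<bullet>c w) / ?l\<^sup>2 \<le> t" if "t > spectral_radius H" for t
      using that l by (simp add: field_simps)
    then have "cmod ((H *\<^sub>v w) \<bullet>c w) / ?l\<^sup>2 \<le> spectral_radius H"
      by (rule dense_ge)
    then show ?thesis using l by (simp add: field_simps)
  qed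
qed

section \<open>The spectrum of A A^dagger and the operator norm of A\<close>

lemma mult_adjoint_cscalar_prod:
  fixes A :: "complex mat"
  assumes A: "A \<in> carrier_mat m n" and w: "w \<in> carrier_vec m"
  shows "((A * mat_adjoint A) *\<^sub>v w) \<bullet>c w
    = complex_of_real ((L2_set (\<lambda>j. cmod ((mat_adjoint A *\<^sub>v w) $ j)) {..<n})\<^sup>2)"
proof -
  have "mat_adjoint A \<in> carrier_mat n m" using A by auto
  then have v: "mat_adjoint A *\<^sub>v w \<in> carrier_vec n" 
    and "(A * mat_adjoint A) *\<^sub>v w = A *\<^sub>v (mat_adjoint A *\<^sub>v w)"
    using A w by (auto simp: assoc_mult_mat_vec[of _ m n])
  then have "((A * mat_adjoint A) *\<^sub>v w) \<bullet>c w = (mat_adjoint A *\<^sub>v w) \<bullet>c (mat_adjoint A *\<^sub>v w)"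
    using mult_mat_vec_cscalar_prod[OF A v w] by simp
  also have "dim_vec (mat_adjoint A *\<^sub>v w) = n" using A by simp
  ultimately show ?thesis using cscalar_prod_self[of "mat_adjoint A *\<^sub>v w"] by simp
qed

lemma mat_adjoint_mult_adjoint:
  fixes A :: "complex mat"
  shows "mat_adjoint (A * mat_adjoint A) = A * mat_adjoint A"
  by (rule eq_matI) (auto simp: scalar_prod_def mult.commute)

text \<open>On an eigenvector \<open>w\<close> the quadratic form gives k * |w|^2 = |A^dagger w|^2,
  so \<open>k\<close> is a quotient of two non-negative reals.\<close>

lemma eigenvalue_mult_adjoint_real:
  fixes A :: "complex mat"
  assumes A: "A \<in> carrier_mat m n" and k: "eigenvalue (A * mat_adjoint A) k"
  shows "\<exists>x\<ge>0. k = complex_of_real x"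
proof -
  obtain w where w: "w \<in> carrier_vec m" "w \<noteq> 0\<^sub>v m" "(A * mat_adjoint A) *\<^sub>v w = k \<cdot>\<^sub>v w"
    using A k by (auto simp: eigenvalue_def eigenvector_def)
  let ?s = "(L2_set (\<lambda>i. cmod (w $ i)) {..<m})\<^sup>2"
  let ?q = "(L2_set (\<lambda>j. cmod ((mat_adjoint A *\<^sub>v w) $ j)) {..<n})\<^sup>2"
  have "k * complex_of_real ?s = complex_of_real ?q"
    using mult_adjoint_cscalar_prod[OF A w(1)] w cscalar_prod_self[of w] by simp
  moreover have "?s \<noteq> 0"
  proof
    assume "?s = 0"
    then have "w \<bullet>c w = 0" using cscalar_prod_self[of w] w(1) by simp
    then show False using w by simp
  qed
  ultimately have "k = complex_of_real (?q / ?s)"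
    by (simp add: field_simps)
  moreover have "?q / ?s \<ge> 0" by simp
  ultimately show ?thesis by blast
qed

text \<open>Eigenvalues of A A^dagger equal their own moduli, so the two maxima run over the same
  set. This gives access to the results on spectral radii.\<close>

lemma max_eigenvalue_eq_spectral_radius:
  fixes A :: "complex mat"
  assumes A: "A \<in> carrier_mat m n"
  shows "max_eigenvalue (A * mat_adjoint A) = spectral_radius (A * mat_adjoint A)"
proof -
  let ?H = "A * mat_adjoint A"
  have "{x. eigenvalue ?H (complex_of_real x)} = norm ` spectrum ?H"
    using eigenvalue_mult_adjoint_real[OF A] by (force simp: spectrum_def)
  then show ?thesis by (simp add: max_eigenvalue_def spectral_radius_def)
qed

text \<open>In one direction |A^dagger w|^2 = <A A^dagger w, w> \<le> t * |w|^2, followed by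
  Cauchy-Schwarz against \<open>y\<close>. In the other, the bilinear bound is evaluated at an
  eigenvector whose eigenvalue has maximal modulus.\<close>

lemma max_eigenvalue_le_iff:
  fixes A :: "complex mat"
  assumes A: "A \<in> carrier_mat m n" and m: "m > 0" and t: "t \<ge> 0"
  shows "max_eigenvalue (A * mat_adjoint A) \<le> t \<longleftrightarrow> bilinear_bound m n (sqrt t) (\<lambda>ij. A $$ ij)"
proof -
  let ?H = "A * mat_adjoint A"
  have H: "?H \<in> carrier_mat m m" using A by auto
  have coord: "(mat_adjoint A *\<^sub>v w) $ j = (\<Sum>i<m. cnj (A $$ (i, j)) * w $ i)"
    if "w \<in> carrier_vec m" "j < n" for w j
    using A that by (auto simp: scalar_prod_def atLeast0LessThan)
  have "bilinear_bound m n (sqrt t) (\<lambda>ij. A $$ ij)" if le: "spectral_radius ?H \<le> t"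
    unfolding bilinear_bound_def
  proof (intro allI)
    fix x y :: "nat \<Rightarrow> complex"
    \<comment> \<open>\<open>bilinear_bound\<close> has no conjugation on \<open>x\<close>, whereas
      the inner product has one; \<open>w\<close> compensates for this.\<close>
    define w where "w = vec m (\<lambda>i. cnj (x i))"
    have w: "w \<in> carrier_vec m" by (simp add: w_def)
    have wi: "w $ i = cnj (x i)" if "i < m" for i using that by (simp add: w_def)
    let ?X = "L2_set (\<lambda>i. cmod (x i)) {..<m}" and ?Y = "L2_set (\<lambda>j. cmod (y j)) {..<n}"
    let ?Z = "L2_set (\<lambda>j. cmod ((mat_adjoint A *\<^sub>v w) $ j)) {..<n}"
    have X: "L2_set (\<lambda>i. cmod (w $ i)) {..<m} = ?X"
      by (intro L2_set_cong) (auto simp: w_def)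
    have "(\<Sum>i<m. \<Sum>j<n. x i * A $$ (i, j) * y j) = (\<Sum>j<n. cnj ((mat_adjoint A *\<^sub>v w) $ j) * y j)"
      by (subst sum.swap, intro sum.cong refl)
        (simp add: coord[OF w] sum_distrib_left sum_distrib_right wi mult_ac)
    then have "cmod (\<Sum>i<m. \<Sum>j<n. x i * A $$ (i, j) * y j) \<le> ?Z * ?Y"
      using norm_sum_mult_le_L2_set[of "\<lambda>j. cnj ((mat_adjoint A *\<^sub>v w) $ j)" y "{..<n}"] by simp
    also have "?Z \<le> sqrt t * ?X"
    proof -
      have "?Z\<^sup>2 = cmod ((?H *\<^sub>v w) \<bullet>c w)"
        by (subst mult_adjoint_cscalar_prod[OF A w]) (simp del: of_real_power)
      also have "\<dots> \<le> spectral_radius ?H * ?X\<^sup>2"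
        using hermitian_cscalar_prod_le_spectral_radius[OF H mat_adjoint_mult_adjoint m w] X by simp
      also have "\<dots> \<le> t * ?X\<^sup>2" using le by (intro mult_right_mono) auto
      finally have "sqrt (?Z\<^sup>2) \<le> sqrt (t * ?X\<^sup>2)" by (rule real_sqrt_le_mono)
      then show ?thesis by (simp add: real_sqrt_mult L2_set_nonneg)
    qed
    finally show "cmod (\<Sum>i<m. \<Sum>j<n. x i * A $$ (i, j) * y j) \<le> sqrt t * ?X * ?Y"
      by (simp add: mult_right_mono L2_set_nonneg)
  qed
  moreover have "spectral_radius ?H \<le> t" if B: "bilinear_bound m n (sqrt t) (\<lambda>ij. A $$ ij)"
  proof -
    obtain k where k: "eigenvalue ?H k" "spectral_radius ?H = cmod k"
      using spectral_radius_mem_max(1)[OF H m] by (auto simp: spectrum_def)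
    then obtain w where w: "w \<in> carrier_vec m" "w \<noteq> 0\<^sub>v m" "?H *\<^sub>v w = k \<cdot>\<^sub>v w"
      using A by (auto simp: eigenvalue_def eigenvector_def)
    let ?W = "L2_set (\<lambda>i. cmod (w $ i)) {..<m}"
    let ?Z = "L2_set (\<lambda>j. cmod ((mat_adjoint A *\<^sub>v w) $ j)) {..<n}"
    have "w \<bullet>c w \<noteq> 0" using w by simp
    then have W: "?W > 0"
      using cscalar_prod_self[of w] w(1) L2_set_nonneg[of "\<lambda>i. cmod (w $ i)" "{..<m}"]
      by (auto simp: less_le)
    have "k * complex_of_real (?W\<^sup>2) = complex_of_real (?Z\<^sup>2)"
      using mult_adjoint_cscalar_prod[OF A w(1)] w cscalar_prod_self[of w] by simp
    then have "cmod (k * complex_of_real (?W\<^sup>2)) = cmod (complex_of_real (?Z\<^sup>2))" by simp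
    then have kW: "cmod k * ?W\<^sup>2 = ?Z\<^sup>2"
      by (simp add: norm_mult norm_power)
    have cz: "cnj ((mat_adjoint A *\<^sub>v w) $ j) = (\<Sum>i<m. cnj (w $ i) * A $$ (i, j))"
      if "j < n" for j
      by (simp add: coord[OF w(1) that] mult.commute)
    \<comment> \<open>The test vectors are conj w and A^dagger w. The form takes the value |A^dagger
      w|^2 there, so one factor |A^dagger w| cancels from the bound unless it is 0.\<close>
    have "(\<Sum>i<m. \<Sum>j<n. cnj (w $ i) * A $$ (i, j) * (mat_adjoint A *\<^sub>v w) $ j)
        = (\<Sum>j<n. cnj ((mat_adjoint A *\<^sub>v w) $ j) * (mat_adjoint A *\<^sub>v w) $ j)"
      by (subst sum.swap, intro sum.cong refl) (simp add: cz sum_distrib_right)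
    also have "\<dots> = complex_of_real (?Z\<^sup>2)"
      by (simp add: L2_set_def sum_nonneg complex_norm_square mult.commute flip: of_real_power)
    finally have "cmod (complex_of_real (?Z\<^sup>2)) \<le> sqrt t * ?W * ?Z"
      using B[unfolded bilinear_bound_def, rule_format,
          of "\<lambda>i. cnj (w $ i)" "\<lambda>j. (mat_adjoint A *\<^sub>v w) $ j"]
      by simp
    then have "?Z * ?Z \<le> (sqrt t * ?W) * ?Z"
      by (simp add: norm_mult power2_eq_square)
    then have "?Z \<le> sqrt t * ?W"
      using L2_set_nonneg[of "\<lambda>j. cmod ((mat_adjoint A *\<^sub>v w) $ j)" "{..<n}"] W t
      by (cases "?Z = 0") (auto simp: mult_le_cancel_right)
    then have "?Z\<^sup>2 \<le> (sqrt t * ?W)\<^sup>2"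
      by (intro power_mono) (auto simp: L2_set_nonneg)
    then have "cmod k * ?W\<^sup>2 \<le> t * ?W\<^sup>2"
      using kW t by (simp add: power_mult_distrib)
    then show ?thesis using W k(2) by simp
  qed
  ultimately show ?thesis
    unfolding max_eigenvalue_eq_spectral_radius[OF A] by blast
qed

section \<open>The circularly symmetric Gaussian law\<close>

text \<open>Lebesgue measure is determined by its values on boxes, and boxes in the complex plane
  are products of intervals. With this the law, defined by real and imaginary parts, obtains a
  density on the complex numbers.\<close>

lemma lborel_eq_distr_Complex:
  "lborel = distr (lborel \<Otimes>\<^sub>M lborel) borel (\<lambda>(x, y). Complex x y)"
proof (rule lborel_eqI)
  have meas: "(\<lambda>(x, y). Complex x y) \<in> lborel \<Otimes>\<^sub>M lborel \<rightarrow>\<^sub>M borel"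
    by (simp add: Complex_eq case_prod_unfold)
  fix l u :: complex assume le: "\<And>b. b \<in> Basis \<Longrightarrow> l \<bullet> b \<le> u \<bullet> b"
  have "Re l \<le> Re u" "Im l \<le> Im u"
    using le[of 1] le[of \<i>] by (auto simp: Basis_complex_def)
  have "(\<lambda>(x, y). Complex x y) -` box l u \<inter> space (lborel \<Otimes>\<^sub>M lborel)
      = {Re l<..<Re u} \<times> {Im l<..<Im u}"
    by (auto simp: space_pair_measure box_def Basis_complex_def)
  then have "emeasure (distr (lborel \<Otimes>\<^sub>M lborel) borel (\<lambda>(x, y). Complex x y)) (box l u)
      = ennreal (Re u - Re l) * ennreal (Im u - Im l)"
    using \<open>Re l \<le> Re u\<close> \<open>Im l \<le> Im u\<close>
    by (simp add: emeasure_distr[OF meas] lborel.emeasure_pair_measure_Times)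
  also have "\<dots> = ennreal (\<Prod>b\<in>Basis. (u - l) \<bullet> b)"
    using \<open>Re l \<le> Re u\<close> \<open>Im l \<le> Im u\<close>
    by (simp add: Basis_complex_def ennreal_mult)
  finally show "emeasure (distr (lborel \<Otimes>\<^sub>M lborel) borel (\<lambda>(x, y). Complex x y)) (box l u)
      = ennreal (\<Prod>b\<in>Basis. (u - l) \<bullet> b)" .
qed simp

lemma normal_density_half_variance:
  assumes "s > 0"
  shows "normal_density 0 (s / sqrt 2) x = exp (- x\<^sup>2 / s\<^sup>2) / sqrt (pi * s\<^sup>2)"
  using assms by (simp add: normal_density_def power_divide)

text \<open>It depends on \<open>z\<close> only through |z|, and the product of several copies only
  through the sum of the |z|^2; all invariance below rests on this.\<close>

definition cscg_density :: "real \<Rightarrow> complex \<Rightarrow> real" where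
  "cscg_density s z = exp (- (cmod z)\<^sup>2 / s\<^sup>2) / (pi * s\<^sup>2)"

lemma borel_measurable_cscg_density [measurable]: "cscg_density s \<in> borel_measurable borel"
  unfolding cscg_density_def by measurable

lemma cscg_density_nonneg: "0 \<le> cscg_density s z"
  by (simp add: cscg_density_def)

lemma normal_density_mult:
  assumes "s > 0"
  shows "normal_density 0 (s / sqrt 2) x * normal_density 0 (s / sqrt 2) y = cscg_density s (Complex x y)"
proof -
  have "exp (- x\<^sup>2 / s\<^sup>2) * exp (- y\<^sup>2 / s\<^sup>2) = exp (- (cmod (Complex x y))\<^sup>2 / s\<^sup>2)"
    by (simp add: cmod_power2 diff_divide_distrib flip: exp_add)
  moreover have "sqrt (pi * s\<^sup>2) * sqrt (pi * s\<^sup>2) = pi * s\<^sup>2"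
    by simp
  ultimately show ?thesis
    unfolding normal_density_half_variance[OF assms] cscg_density_def times_divide_times_eq by simp
qed

lemma cscg_eq_density:
  assumes s: "s > 0"
  shows "cscg s = density lborel (\<lambda>z. ennreal (cscg_density s z))"
proof -
  let ?g = "normal_density 0 (s / sqrt 2)"
  have meas [measurable]: "(\<lambda>(x, y). Complex x y) \<in> lborel \<Otimes>\<^sub>M lborel \<rightarrow>\<^sub>M borel"
    by (simp add: Complex_eq case_prod_unfold)
  interpret N: prob_space "density lborel ?g"
    using s by (intro prob_space_normal_density) simp
  have "density lborel ?g \<Otimes>\<^sub>M density lborel ?g
      = density (lborel \<Otimes>\<^sub>M lborel) (\<lambda>(x, y). ennreal (?g x) * ennreal (?g y))"
    by (rule pair_measure_density) (auto intro: N.sigma_finite_measure_axioms sigma_finite_lborel)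
  also have "(\<lambda>(x, y). ennreal (?g x) * ennreal (?g y))
      = (\<lambda>p. ennreal (cscg_density s (case p of (x, y) \<Rightarrow> Complex x y)))"
    by (auto simp: normal_density_mult[OF s] simp flip: ennreal_mult)
  finally show ?thesis
    unfolding cscg_def
    by (subst lborel_eq_distr_Complex) (simp add: density_distr)
qed

lemma sets_cscg [simp, measurable_cong]: "sets (cscg s) = sets borel"
  and space_cscg [simp]: "space (cscg s) = UNIV"
  by (simp_all add: cscg_def)

lemma prob_space_cscg:
  assumes s: "s > 0"
  shows "prob_space (cscg s)"
proof -
  let ?N = "density lborel (normal_density 0 (s / sqrt 2))"
  interpret N: prob_space ?N
    using s by (intro prob_space_normal_density) simp
  interpret NN: pair_prob_space ?N ?N ..
  show ?thesis unfolding cscg_def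
    by (rule NN.prob_space_distr) (simp add: Complex_eq case_prod_unfold)
qed

text \<open>With one variable fixed, a shear is a translation of the other, so translation
  invariance and Fubini suffice and no Jacobian is computed. The type covers both the complex
  numbers (two entries of a matrix) and the reals (the two parts of one entry).\<close>

lemma nn_integral_shear:
  fixes F :: "'a::{euclidean_space, real_normed_field} \<Rightarrow> 'a \<Rightarrow> ennreal"
  assumes [measurable]: "case_prod F \<in> borel_measurable (borel \<Otimes>\<^sub>M borel)"
  shows "(\<integral>\<^sup>+z. \<integral>\<^sup>+w. F z (c * z + w) \<partial>lborel \<partial>lborel) = (\<integral>\<^sup>+z. \<integral>\<^sup>+w. F z w \<partial>lborel \<partial>lborel)"
    and "(\<integral>\<^sup>+z. \<integral>\<^sup>+w. F (z + c * w) w \<partial>lborel \<partial>lborel) = (\<integral>\<^sup>+z. \<integral>\<^sup>+w. F z w \<partial>lborel \<partial>lborel)"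
proof -
  have translate: "(\<integral>\<^sup>+w. f (t + w) \<partial>lborel) = (\<integral>\<^sup>+w. f w \<partial>lborel)"
    if [measurable]: "f \<in> borel_measurable borel" for f :: "'a \<Rightarrow> ennreal" and t
  proof -
    have "(\<integral>\<^sup>+w. f w \<partial>lborel) = (\<integral>\<^sup>+w. f w \<partial>distr lborel borel ((+) t))"
      by (simp add: lborel_distr_plus)
    also have "\<dots> = (\<integral>\<^sup>+w. f (t + w) \<partial>lborel)"
      by (subst nn_integral_distr) auto
    finally show ?thesis ..
  qed
  show "(\<integral>\<^sup>+z. \<integral>\<^sup>+w. F z (c * z + w) \<partial>lborel \<partial>lborel) = (\<integral>\<^sup>+z. \<integral>\<^sup>+w. F z w \<partial>lborel \<partial>lborel)"
    by (intro nn_integral_cong translate) measurable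
  have "(\<integral>\<^sup>+z. \<integral>\<^sup>+w. F (z + c * w) w \<partial>lborel \<partial>lborel) = (\<integral>\<^sup>+w. \<integral>\<^sup>+z. F (c * w + z) w \<partial>lborel \<partial>lborel)"
    by (subst lborel_pair.Fubini') (simp_all add: add.commute)
  also have "\<dots> = (\<integral>\<^sup>+w. \<integral>\<^sup>+z. F z w \<partial>lborel \<partial>lborel)"
    by (intro nn_integral_cong translate[where f = "\<lambda>z. F z _"]) measurable
  also have "\<dots> = (\<integral>\<^sup>+z. \<integral>\<^sup>+w. F z w \<partial>lborel \<partial>lborel)"
    by (subst lborel_pair.Fubini') simp_all
  finally show "(\<integral>\<^sup>+z. \<integral>\<^sup>+w. F (z + c * w) w \<partial>lborel \<partial>lborel) = (\<integral>\<^sup>+z. \<integral>\<^sup>+w. F z w \<partial>lborel \<partial>lborel)" .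
qed

text \<open>A matrix of determinant 1 with nonzero lower left entry is a product of three shears.\<close>

lemma nn_integral_unimodular:
  fixes F :: "'a::{euclidean_space, real_normed_field} \<Rightarrow> 'a \<Rightarrow> ennreal"
  assumes F [measurable]: "case_prod F \<in> borel_measurable (borel \<Otimes>\<^sub>M borel)"
    and det: "a * d - b * c = 1" and c: "c \<noteq> 0"
  shows "(\<integral>\<^sup>+z. \<integral>\<^sup>+w. F (a * z + b * w) (c * z + d * w) \<partial>lborel \<partial>lborel)
    = (\<integral>\<^sup>+z. \<integral>\<^sup>+w. F z w \<partial>lborel \<partial>lborel)"
proof -
  \<comment> \<open>The factorisation is [a b; c d] = [1 x; 0 1] [1 0; c 1] [1 y; 0 1]. The diagonal
    entries determine \<open>x\<close> and \<open>y\<close>; the determinant condition then makes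
    the upper right entry correct.\<close>
  define x where "x = (a - 1) / c"
  define y where "y = (d - 1) / c"
  have xy: "a = 1 + x * c" "d = 1 + c * y" "b = y + x * d"
    using c det by (auto simp: x_def y_def field_simps)
  have "(\<integral>\<^sup>+z. \<integral>\<^sup>+w. F z w \<partial>lborel \<partial>lborel)
      = (\<integral>\<^sup>+z. \<integral>\<^sup>+w. F (z + x * w) w \<partial>lborel \<partial>lborel)"
    by (rule nn_integral_shear(2)[symmetric]) measurable
  also have "\<dots> = (\<integral>\<^sup>+z. \<integral>\<^sup>+w. F (z + x * (c * z + w)) (c * z + w) \<partial>lborel \<partial>lborel)"
    by (rule nn_integral_shear(1)[symmetric, where F = "\<lambda>z w. F (z + x * w) w"]) measurable
  also have "\<dots> = (\<integral>\<^sup>+z. \<integral>\<^sup>+w. F (z + y * w + x * (c * (z + y * w) + w)) (c * (z + y * w) + w) \<partial>lborel \<partial>lborel)"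
    by (rule nn_integral_shear(2)[symmetric, where F = "\<lambda>z w. F (z + x * (c * z + w)) (c * z + w)"]) measurable
  also have "\<dots> = (\<integral>\<^sup>+z. \<integral>\<^sup>+w. F (a * z + b * w) (c * z + d * w) \<partial>lborel \<partial>lborel)"
    by (simp add: xy algebra_simps)
  finally show ?thesis ..
qed

text \<open>The substitution has determinant |a|^2 + |b|^2 = 1 and preserves |z|^2 + |w|^2, hence
  both Lebesgue measure and the joint density. The condition on \<open>b\<close> is the nonzero
  lower left entry that the factorisation into shears requires.\<close>

lemma nn_integral_cscg_pair_unitary:
  fixes F :: "complex \<Rightarrow> complex \<Rightarrow> ennreal"
  assumes s: "s > 0" and [measurable]: "case_prod F \<in> borel_measurable (borel \<Otimes>\<^sub>M borel)"
    and ab: "(cmod a)\<^sup>2 + (cmod b)\<^sup>2 = 1" and b: "b \<noteq> 0"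
  shows "(\<integral>\<^sup>+z. \<integral>\<^sup>+w. F (a * z + b * w) (- cnj b * z + cnj a * w) \<partial>cscg s \<partial>cscg s)
    = (\<integral>\<^sup>+z. \<integral>\<^sup>+w. F z w \<partial>cscg s \<partial>cscg s)"
proof -
  let ?D = "\<lambda>z. ennreal (cscg_density s z)"
  have dens: "(\<integral>\<^sup>+z. \<integral>\<^sup>+w. G z w \<partial>cscg s \<partial>cscg s)
      = (\<integral>\<^sup>+z. \<integral>\<^sup>+w. ?D z * ?D w * G z w \<partial>lborel \<partial>lborel)"
    if [measurable]: "case_prod G \<in> borel_measurable (borel \<Otimes>\<^sub>M borel)" for G
    unfolding cscg_eq_density[OF s]
    by (subst nn_integral_density, simp, measurable)
      (simp add: nn_integral_density nn_integral_cmult mult.assoc)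
  have inv: "?D (a * z + b * w) * ?D (- cnj b * z + cnj a * w) = ?D z * ?D w" for z w
  proof -
    have "complex_of_real ((cmod (a * z + b * w))\<^sup>2 + (cmod (- cnj b * z + cnj a * w))\<^sup>2)
        = complex_of_real (((cmod a)\<^sup>2 + (cmod b)\<^sup>2) * ((cmod z)\<^sup>2 + (cmod w)\<^sup>2))"
      unfolding of_real_add of_real_mult complex_norm_square by (simp add: algebra_simps)
    then have eq: "(cmod (a * z + b * w))\<^sup>2 + (cmod (- cnj b * z + cnj a * w))\<^sup>2 = (cmod z)\<^sup>2 + (cmod w)\<^sup>2"
      unfolding of_real_eq_iff ab by simp
    have "cscg_density s u * cscg_density s v
        = exp (- ((cmod u)\<^sup>2 + (cmod v)\<^sup>2) / s\<^sup>2) / (pi * s\<^sup>2)\<^sup>2" for u v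
      by (simp add: cscg_density_def power2_eq_square[of "pi * s\<^sup>2"] add_divide_distrib diff_divide_distrib exp_add
          flip: exp_add)
    then have "cscg_density s (a * z + b * w) * cscg_density s (- cnj b * z + cnj a * w)
        = cscg_density s z * cscg_density s w"
      by (simp only: eq)
    then show ?thesis by (simp only: cscg_density_nonneg flip: ennreal_mult)
  qed
  have "(\<integral>\<^sup>+z. \<integral>\<^sup>+w. F (a * z + b * w) (- cnj b * z + cnj a * w) \<partial>cscg s \<partial>cscg s)
     = (\<integral>\<^sup>+z. \<integral>\<^sup>+w. ?D (a * z + b * w) * ?D (- cnj b * z + cnj a * w)
          * F (a * z + b * w) (- cnj b * z + cnj a * w) \<partial>lborel \<partial>lborel)"
    by (subst dens) (simp_all only: inv, measurable)
  also have "\<dots> = (\<integral>\<^sup>+z. \<integral>\<^sup>+w. ?D z * ?D w * F z w \<partial>lborel \<partial>lborel)"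
  proof (rule nn_integral_unimodular[where F = "\<lambda>z w. ?D z * ?D w * F z w"])
    show "a * cnj a - b * - cnj b = 1"
      using arg_cong[OF ab, of complex_of_real] by (simp add: complex_norm_square del: of_real_power)
  qed (use b in \<open>auto, measurable\<close>)
  also have "\<dots> = (\<integral>\<^sup>+z. \<integral>\<^sup>+w. F z w \<partial>cscg s \<partial>cscg s)"
    by (rule dens[symmetric]) measurable
  finally show ?thesis .
qed

text \<open>Multiplication by a unit is a real rotation of the plane whose lower left entry is the
  imaginary part. The shears therefore treat non-real units, and the units 1 and -1 are reached by
  composing two of those.\<close>

lemma distr_cscg_mult_unit:
  assumes s: "s > 0" and \<zeta>: "cmod \<zeta> = 1"
  shows "distr (cscg s) (cscg s) (\<lambda>z. \<zeta> * z) = cscg s"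
proof -
  have rot: "distr (cscg s) (cscg s) (\<lambda>z. \<xi> * z) = cscg s"
    if \<xi>: "cmod \<xi> = 1" and im: "Im \<xi> \<noteq> 0" for \<xi>
  proof (rule measure_eqI)
    fix A assume "A \<in> sets (distr (cscg s) (cscg s) (\<lambda>z. \<xi> * z))"
    then have A [measurable]: "A \<in> sets borel" by simp
    let ?C = "\<lambda>x y. Complex x y"
    have C [measurable]: "(\<lambda>p. Complex (fst p) (snd p)) \<in> borel \<Otimes>\<^sub>M borel \<rightarrow>\<^sub>M borel"
      by (simp add: Complex_eq)
    define G where "G = (\<lambda>z. ennreal (cscg_density s z) * indicator A z)"
    have [measurable]: "G \<in> borel_measurable borel" unfolding G_def by measurable
    have Gxy: "(\<lambda>(x, y). G (Complex x y)) \<in> borel_measurable (borel \<Otimes>\<^sub>M borel)"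
      using measurable_compose[OF C, of G borel] by (simp add: case_prod_unfold)
    have int: "(\<integral>\<^sup>+z. H z \<partial>lborel) = (\<integral>\<^sup>+x. \<integral>\<^sup>+y. H (Complex x y) \<partial>lborel \<partial>lborel)"
      if [measurable]: "H \<in> borel_measurable borel" for H
      using measurable_compose[OF C, of H borel]
      by (subst lborel_eq_distr_Complex, subst nn_integral_distr)
        (auto simp: case_prod_unfold lborel.nn_integral_fst[symmetric])
    have "emeasure (distr (cscg s) (cscg s) (\<lambda>z. \<xi> * z)) A = (\<integral>\<^sup>+z. indicator A (\<xi> * z) \<partial>cscg s)"
      by (subst nn_integral_indicator[symmetric], simp, subst nn_integral_distr) auto
    also have "\<dots> = (\<integral>\<^sup>+z. G (\<xi> * z) \<partial>lborel)"
      unfolding cscg_eq_density[OF s]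
      by (subst nn_integral_density) (auto simp: G_def cscg_density_def norm_mult \<xi>)
    also have "\<dots> = (\<integral>\<^sup>+x. \<integral>\<^sup>+y. G (Complex (Re \<xi> * x + - Im \<xi> * y) (Im \<xi> * x + Re \<xi> * y)) \<partial>lborel \<partial>lborel)"
      by (subst int) (auto simp: intro!: nn_integral_cong arg_cong[where f = G] complex_eqI)
    also have "\<dots> = (\<integral>\<^sup>+x. \<integral>\<^sup>+y. G (Complex x y) \<partial>lborel \<partial>lborel)"
      using \<xi> im
      by (intro nn_integral_unimodular[where F = "\<lambda>x y. G (Complex x y)"] Gxy)
        (auto simp: cmod_def power2_eq_square)
    also have "\<dots> = (\<integral>\<^sup>+z. G z \<partial>lborel)" by (subst int) auto
    also have "\<dots> = emeasure (cscg s) A"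
      unfolding cscg_eq_density[OF s] by (simp add: emeasure_density G_def)
    finally show "emeasure (distr (cscg s) (cscg s) (\<lambda>z. \<xi> * z)) A = emeasure (cscg s) A" .
  qed simp
  show ?thesis
  proof (cases "Im \<zeta> = 0")
    case False
    then show ?thesis using rot \<zeta> by blast
  next
    case True
    \<comment> \<open>then \<open>- \<i> * \<zeta>\<close> is not real, and \<open>\<zeta> = \<i> * (- \<i> * \<zeta>)\<close>\<close>
    then have "Re \<zeta> \<noteq> 0" using \<zeta> by (auto simp: cmod_def)
    have "cscg s = distr (distr (cscg s) (cscg s) (\<lambda>z. (- \<i> * \<zeta>) * z)) (cscg s) (\<lambda>z. \<i> * z)"
      using rot[of "- \<i> * \<zeta>"] rot[of \<i>] \<zeta> \<open>Re \<zeta> \<noteq> 0\<close> by (simp add: norm_mult)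
    also have "\<dots> = distr (cscg s) (cscg s) (\<lambda>z. \<zeta> * z)"
      by (subst distr_distr) (auto simp: comp_def mult.assoc[symmetric])
    finally show ?thesis ..
  qed
qed

section \<open>Unitary invariance\<close>

lemma product_prob_space_cscg: "s > 0 \<Longrightarrow> product_prob_space (\<lambda>_. cscg s)"
  by (intro product_prob_spaceI prob_space_cscg)

lemma prob_space_cscg_entries: "s > 0 \<Longrightarrow> prob_space (cscg_entries m n s)"
  unfolding cscg_entries_def by (intro prob_space_PiM prob_space_cscg)

text \<open>A complex Givens rotation: the matrix [a b; -conj b conj a], unitary if |a|^2 + |b|^2 =
  1, acts on the coordinates \<open>p\<close> and \<open>q\<close>.\<close>

definition rotate2 :: "complex \<Rightarrow> complex \<Rightarrow> 'i \<Rightarrow> 'i \<Rightarrow> ('i \<Rightarrow> complex) \<Rightarrow> 'i \<Rightarrow> complex" where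
  "rotate2 a b p q x = x(p := a * x p + b * x q, q := - cnj b * x p + cnj a * x q)"

lemma rotate2_measurable:
  assumes "p \<in> I" "q \<in> I"
  shows "rotate2 a b p q \<in> PiM I (\<lambda>_. cscg s) \<rightarrow>\<^sub>M PiM I (\<lambda>_. cscg s)"
proof (rule measurable_PiM_single')
  fix i assume i: "i \<in> I"
  have [measurable]: "(\<lambda>x. x j) \<in> borel_measurable (PiM I (\<lambda>_. cscg s))" if "j \<in> I" for j
    using measurable_component_singleton[OF that, of "\<lambda>_. cscg s"]
    by (simp cong: measurable_cong_sets)
  note [measurable] = assms i
  show "(\<lambda>x. rotate2 a b p q x i) \<in> PiM I (\<lambda>_. cscg s) \<rightarrow>\<^sub>M cscg s"
    unfolding rotate2_def fun_upd_def
    by (cases "i = q"; cases "i = p") (simp_all cong: measurable_cong_sets)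
qed (use assms in \<open>auto simp: rotate2_def space_PiM PiE_def extensional_def\<close>)

text \<open>All coordinates other than \<open>p\<close> and \<open>q\<close> are frozen by Fubini;
  on the remaining pair this is the invariance of two independent Gaussians.\<close>

lemma distr_rotate2:
  assumes s: "s > 0" and I: "finite I" "p \<in> I" "q \<in> I" "p \<noteq> q"
    and ab: "(cmod a)\<^sup>2 + (cmod b)\<^sup>2 = 1" "b \<noteq> 0"
  shows "distr (PiM I (\<lambda>_. cscg s)) (PiM I (\<lambda>_. cscg s)) (rotate2 a b p q) = PiM I (\<lambda>_. cscg s)"
proof (rule measure_eqI)
  let ?M = "\<lambda>_ :: 'a. cscg s"
  interpret product_prob_space ?M using s by (rule product_prob_space_cscg)
  define J where "J = I - {p, q}"
  have J: "I = insert p (insert q J)" "finite J" "p \<notin> insert q J" "q \<notin> J" "finite (insert q J)"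
    using I by (auto simp: J_def)
  note rot [measurable] = rotate2_measurable[OF I(2,3), of a b s]
  have expand: "(\<integral>\<^sup>+\<omega>. f \<omega> \<partial>PiM I ?M) = (\<integral>\<^sup>+x. \<integral>\<^sup>+w. \<integral>\<^sup>+z. f (x(q := w, p := z)) \<partial>cscg s \<partial>cscg s \<partial>PiM J ?M)"
    if f: "f \<in> borel_measurable (PiM I ?M)" for f
  proof -
    have f' [measurable]: "f \<in> borel_measurable (PiM (insert p (insert q J)) ?M)" using f J(1) by simp
    have "(\<lambda>y. \<integral>\<^sup>+z. f (y(p := z)) \<partial>cscg s) \<in> borel_measurable (PiM (insert q J) ?M)"
      by measurable
    then show ?thesis
      unfolding J(1)
      by (subst product_nn_integral_insert[OF J(5,3) f'], subst product_nn_integral_insert[OF J(2,4)]) auto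
  qed
  fix A assume "A \<in> sets (distr (PiM I ?M) (PiM I ?M) (rotate2 a b p q))"
  then have A [measurable]: "A \<in> sets (PiM I ?M)" by simp
  have "emeasure (distr (PiM I ?M) (PiM I ?M) (rotate2 a b p q)) A
      = (\<integral>\<^sup>+\<omega>. indicator A (rotate2 a b p q \<omega>) \<partial>PiM I ?M)"
    by (subst nn_integral_indicator[symmetric], simp, subst nn_integral_distr) auto
  also have "\<dots> = (\<integral>\<^sup>+x. \<integral>\<^sup>+w. \<integral>\<^sup>+z. indicator A (rotate2 a b p q (x(q := w, p := z))) \<partial>cscg s \<partial>cscg s \<partial>PiM J ?M)"
    by (subst expand) auto
  also have "\<dots> = (\<integral>\<^sup>+x. \<integral>\<^sup>+w. \<integral>\<^sup>+z. indicator A (x(q := w, p := z)) \<partial>cscg s \<partial>cscg s \<partial>PiM J ?M)"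
  proof (rule nn_integral_cong)
    fix x assume x: "x \<in> space (PiM J ?M)"
    have upd: "(\<lambda>v. x(q := snd v, p := fst v)) \<in> cscg s \<Otimes>\<^sub>M cscg s \<rightarrow>\<^sub>M PiM I ?M"
      using x unfolding J(1)
      by (intro measurable_PiM_single') (auto simp: space_PiM PiE_def extensional_def)
    have "sets (borel \<Otimes>\<^sub>M borel :: (complex \<times> complex) measure) = sets (cscg s \<Otimes>\<^sub>M cscg s)"
      by (intro sets_pair_measure_cong) simp_all
    then have "(\<lambda>v. indicator A (x(q := snd v, p := fst v)) :: ennreal) \<in> borel_measurable (borel \<Otimes>\<^sub>M borel)"
      using measurable_compose[OF upd borel_measurable_indicator[OF A]]
      by (simp cong: measurable_cong_sets)
    then have F: "(\<lambda>(z, w). indicator A (x(q := w, p := z)) :: ennreal) \<in> borel_measurable (borel \<Otimes>\<^sub>M borel)"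
      by (simp add: case_prod_unfold)
    interpret P: pair_sigma_finite "cscg s" "cscg s"
      by unfold_locales
    show "(\<integral>\<^sup>+w. \<integral>\<^sup>+z. indicator A (rotate2 a b p q (x(q := w, p := z))) \<partial>cscg s \<partial>cscg s)
        = (\<integral>\<^sup>+w. \<integral>\<^sup>+z. (indicator A (x(q := w, p := z)) :: ennreal) \<partial>cscg s \<partial>cscg s)"
    proof -
      have rot_upd: "rotate2 a b p q (x(q := w, p := z)) = x(q := - cnj b * z + cnj a * w, p := a * z + b * w)"
        for z w
        using I(4) by (auto simp: rotate2_def fun_eq_iff)
      have F': "(\<lambda>(z, w). indicator A (x(q := w, p := z)) :: ennreal) \<in> borel_measurable (cscg s \<Otimes>\<^sub>M cscg s)"
        "(\<lambda>(z, w). indicator A (rotate2 a b p q (x(q := w, p := z))) :: ennreal) \<in> borel_measurable (cscg s \<Otimes>\<^sub>M cscg s)"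
        using measurable_compose[OF upd borel_measurable_indicator[OF A]]
          measurable_compose[OF upd measurable_compose[OF rot borel_measurable_indicator[OF A]]]
        by (simp_all add: case_prod_unfold)
      show ?thesis
        using nn_integral_cscg_pair_unitary[OF s F ab]
        \<comment> \<open>The splitting of the product integrates coordinate \<open>p\<close>
          innermost, the statement about pairs has it outermost; both sides are swapped.\<close>
        by (subst (1 2) P.Fubini') (use F' in \<open>simp_all add: rot_upd\<close>)
    qed
  qed
  also have "\<dots> = emeasure (PiM I ?M) A"
    by (subst expand[symmetric]) auto
  finally show "emeasure (distr (PiM I ?M) (PiM I ?M) (rotate2 a b p q)) A = emeasure (PiM I ?M) A" .
qed simp

text \<open>Left multiplication by a Givens rotation, restricted to the columns in \<open>J\<close>,
  so that columns can be processed one at a time.\<close>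

definition rotate_rows ::
  "complex \<Rightarrow> complex \<Rightarrow> nat \<Rightarrow> nat \<Rightarrow> nat set \<Rightarrow> (nat \<times> nat \<Rightarrow> complex) \<Rightarrow> nat \<times> nat \<Rightarrow> complex" where
  "rotate_rows a b p q J M = (\<lambda>(i, j). if j \<in> J then rotate2 a b p q (\<lambda>i. M (i, j)) i else M (i, j))"

text \<open>Induction on the number of treated columns: one more column is one more rotation of the
  pair of entries in rows \<open>p\<close> and \<open>q\<close>, and compositions of
  measure-preserving maps preserve the measure.\<close>

lemma distr_rotate_rows:
  assumes s: "s > 0" and pq: "p < m" "q < m" "p \<noteq> q"
    and ab: "(cmod a)\<^sup>2 + (cmod b)\<^sup>2 = 1" "b \<noteq> 0"
  shows "rotate_rows a b p q {..<n} \<in> cscg_entries m n s \<rightarrow>\<^sub>M cscg_entries m n s"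
    and "distr (cscg_entries m n s) (cscg_entries m n s) (rotate_rows a b p q {..<n}) = cscg_entries m n s"
proof -
  let ?I = "{..<m} \<times> {..<n}" and ?E = "cscg_entries m n s"
  have "rotate_rows a b p q {..<k} \<in> ?E \<rightarrow>\<^sub>M ?E \<and> distr ?E ?E (rotate_rows a b p q {..<k}) = ?E"
    if "k \<le> n" for k
    using that
  proof (induction k)
    case 0
    have "rotate_rows a b p q {} = (\<lambda>M. M)" by (auto simp: rotate_rows_def)
    then show ?case by (simp add: distr_id)
  next
    case (Suc k)
    have k: "(p, k) \<in> ?I" "(q, k) \<in> ?I" "(p, k) \<noteq> (q, k)" using Suc.prems pq by auto
    note m1 = rotate2_measurable[OF k(1,2), of a b s, folded cscg_entries_def]
    note d1 = distr_rotate2[OF s _ k ab, folded cscg_entries_def]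
    have eq: "rotate_rows a b p q {..<Suc k} = rotate2 a b (p, k) (q, k) \<circ> rotate_rows a b p q {..<k}"
      using pq by (auto simp: rotate_rows_def rotate2_def fun_eq_iff)
    have IH: "rotate_rows a b p q {..<k} \<in> ?E \<rightarrow>\<^sub>M ?E" "distr ?E ?E (rotate_rows a b p q {..<k}) = ?E"
      using Suc by auto
    have "distr ?E ?E (rotate2 a b (p, k) (q, k) \<circ> rotate_rows a b p q {..<k})
        = distr (distr ?E ?E (rotate_rows a b p q {..<k})) ?E (rotate2 a b (p, k) (q, k))"
      by (rule distr_distr[symmetric]) (rule m1 IH(1))+
    also have "\<dots> = ?E"
      using d1 IH(2) by simp
    finally show ?case
      unfolding eq using measurable_comp[OF IH(1) m1] by blast
  qed
  then show "rotate_rows a b p q {..<n} \<in> ?E \<rightarrow>\<^sub>M ?E" "distr ?E ?E (rotate_rows a b p q {..<n}) = ?E"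
    by auto
qed

lemma L2_set_rotate2:
  fixes p q m :: nat
  assumes pq: "p < m" "q < m" "p \<noteq> q" and ab: "(cmod a)\<^sup>2 + (cmod b)\<^sup>2 = 1"
  shows "L2_set (\<lambda>i. cmod (rotate2 a b p q x i)) {..<m} = L2_set (\<lambda>i. cmod (x i)) {..<m}"
proof -
  have split: "(\<Sum>i<m. f i) = f p + f q + (\<Sum>i\<in>{..<m} - {p, q}. f i)" for f :: "nat \<Rightarrow> real"
    using pq sum.subset_diff[of "{p, q}" "{..<m}" f] by simp
  have "complex_of_real ((cmod (a * z + b * w))\<^sup>2 + (cmod (- cnj b * z + cnj a * w))\<^sup>2)
      = complex_of_real (((cmod a)\<^sup>2 + (cmod b)\<^sup>2) * ((cmod z)\<^sup>2 + (cmod w)\<^sup>2))" for z w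
    unfolding of_real_add of_real_mult complex_norm_square by (simp add: algebra_simps)
  then have "(cmod (a * z + b * w))\<^sup>2 + (cmod (- cnj b * z + cnj a * w))\<^sup>2 = (cmod z)\<^sup>2 + (cmod w)\<^sup>2" for z w
    unfolding of_real_eq_iff ab by simp
  then show ?thesis
    using pq by (simp add: L2_set_def split rotate2_def)
qed

text \<open>The rotation is moved to the test vector \<open>x\<close>, whose norm it preserves. The
  converse follows by applying the same implication to the inverse rotation, which has parameters
  conj a and -b.\<close>

lemma bilinear_bound_rotate_rows:
  fixes p q m :: nat
  assumes pq: "p < m" "q < m" "p \<noteq> q" and ab: "(cmod a)\<^sup>2 + (cmod b)\<^sup>2 = 1"
  shows "bilinear_bound m n r (rotate_rows a b p q {..<n} M) \<longleftrightarrow> bilinear_bound m n r M"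
proof -
  have dir: "bilinear_bound m n r (rotate_rows a b p q {..<n} M)"
    if B: "bilinear_bound m n r M" and ab: "(cmod a)\<^sup>2 + (cmod b)\<^sup>2 = 1" for a b M
    unfolding bilinear_bound_def
  proof (intro allI)
    fix x y :: "nat \<Rightarrow> complex"
    define S where "S i = (\<Sum>j<n. M (i, j) * y j)" for i
    have split: "(\<Sum>i<m. f i) = f p + f q + (\<Sum>i\<in>{..<m} - {p, q}. f i)" for f :: "nat \<Rightarrow> complex"
      using pq sum.subset_diff[of "{p, q}" "{..<m}" f] by simp
    have "(\<Sum>j<n. rotate_rows a b p q {..<n} M (i, j) * y j) = rotate2 a b p q S i" for i
      by (auto simp: rotate_rows_def rotate2_def S_def sum.distrib sum_distrib_left algebra_simps sum_subtractf sum_negf)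
    then have "(\<Sum>i<m. \<Sum>j<n. x i * rotate_rows a b p q {..<n} M (i, j) * y j)
        = (\<Sum>i<m. x i * rotate2 a b p q S i)"
      by (simp add: mult.assoc flip: sum_distrib_left)
    \<comment> \<open>Since the form is bilinear, the rotation passes over as its transpose, not its
      adjoint; transposing replaces \<open>b\<close> by -conj b and keeps \<open>a\<close>.\<close>
    also have "\<dots> = (\<Sum>i<m. rotate2 a (- cnj b) p q x i * S i)"
      using pq by (simp add: split rotate2_def algebra_simps)
    also have "\<dots> = (\<Sum>i<m. \<Sum>j<n. rotate2 a (- cnj b) p q x i * M (i, j) * y j)"
      by (simp add: S_def sum_distrib_left mult.assoc)
    finally show "cmod (\<Sum>i<m. \<Sum>j<n. x i * rotate_rows a b p q {..<n} M (i, j) * y j)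
        \<le> r * L2_set (\<lambda>i. cmod (x i)) {..<m} * L2_set (\<lambda>j. cmod (y j)) {..<n}"
      using B[unfolded bilinear_bound_def, rule_format, of "rotate2 a (- cnj b) p q x" y]
        L2_set_rotate2[OF pq, of a "- cnj b" x] ab by simp
  qed
  have "rotate_rows (cnj a) (- b) p q {..<n} (rotate_rows a b p q {..<n} M) ij = M ij" for ij
  proof -
    obtain i j where ij: "ij = (i, j)" by fastforce
    have *: "cnj a * a + b * cnj b = 1"
      using arg_cong[OF ab, of complex_of_real] by (simp add: complex_norm_square mult.commute del: of_real_power)
    have "cnj a * (a * z + b * w) + - b * (- cnj b * z + cnj a * w) = (cnj a * a + b * cnj b) * z"
      "cnj b * (a * z + b * w) + a * (- cnj b * z + cnj a * w) = (cnj a * a + b * cnj b) * w" for z w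
      by (simp_all add: algebra_simps)
    then show ?thesis using pq * by (auto simp: ij rotate_rows_def rotate2_def)
  qed
  then have "rotate_rows (cnj a) (- b) p q {..<n} (rotate_rows a b p q {..<n} M) = M" by blast
  with dir[of M a b] dir[of "rotate_rows a b p q {..<n} M" "cnj a" "- b"] ab show ?thesis by auto
qed

section \<open>Outage probabilities for an arbitrary mean matrix and their symmetries\<close>

definition offset_prob :: "nat \<Rightarrow> nat \<Rightarrow> real \<Rightarrow> real \<Rightarrow> (nat \<times> nat \<Rightarrow> complex) \<Rightarrow> real" where
  "offset_prob m n s r A =
     \<P>(\<omega> in cscg_entries m n s. bilinear_bound m n r (\<lambda>ij. A ij + \<omega> ij))"

lemma bilinear_bound_cong:
  assumes "\<And>i j. i < m \<Longrightarrow> j < n \<Longrightarrow> M (i, j) = M' (i, j)"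
  shows "bilinear_bound m n r M \<longleftrightarrow> bilinear_bound m n r M'"
  using assms by (simp add: bilinear_bound_def)

lemma offset_prob_cong:
  assumes "\<And>i j. i < m \<Longrightarrow> j < n \<Longrightarrow> A (i, j) = A' (i, j)"
  shows "offset_prob m n s r A = offset_prob m n s r A'"
proof -
  have "bilinear_bound m n r (\<lambda>ij. A ij + \<omega> ij) \<longleftrightarrow> bilinear_bound m n r (\<lambda>ij. A' ij + \<omega> ij)" for \<omega>
    using assms by (intro bilinear_bound_cong) auto
  then show ?thesis by (simp add: offset_prob_def)
qed

text \<open>The condition quantifies over uncountably many test vectors, so measurability comes from
  topology: an intersection of closed sets is closed in the product topology. The index type is
  countable, hence the Borel sets there are the product sigma-algebra over all indices; coordinates
  outside the matrix are the constant \<open>undefined\<close>.\<close>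

lemma sets_bilinear_bound:
  "{\<omega> \<in> space (cscg_entries m n s). bilinear_bound m n r (\<lambda>ij. A ij + \<omega> ij)} \<in> sets (cscg_entries m n s)"
proof -
  have cont: "continuous_on UNIV (\<lambda>M :: nat \<times> nat \<Rightarrow> complex. M ij)" for ij
    by (intro continuous_on_product_coordinates)
  have closed: "closed {M. bilinear_bound m n r (\<lambda>ij. A ij + M ij)}"
    unfolding bilinear_bound_def
    by (intro closed_Collect_all closed_Collect_le continuous_intros cont)
  have "(\<lambda>\<omega>. \<omega>) \<in> cscg_entries m n s \<rightarrow>\<^sub>M (\<Pi>\<^sub>M ij \<in> UNIV. borel)"
  proof (rule measurable_PiM_single')
    fix ij :: "nat \<times> nat"
    show "(\<lambda>\<omega>. \<omega> ij) \<in> borel_measurable (cscg_entries m n s)"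
    proof (cases "ij \<in> {..<m} \<times> {..<n}")
      case True
      then show ?thesis
        using measurable_component_singleton[OF True, of "\<lambda>_. cscg s"]
        by (simp add: cscg_entries_def cong: measurable_cong_sets)
    next
      case False
      then have "\<omega> ij = undefined" if "\<omega> \<in> space (cscg_entries m n s)" for \<omega>
        using that by (cases ij) (auto simp: cscg_entries_def space_PiM PiE_def extensional_def)
      then show ?thesis by (subst measurable_cong[where g = "\<lambda>_. undefined"]) auto
    qed
  qed auto
  then have "(\<lambda>\<omega>. \<omega>) \<in> cscg_entries m n s \<rightarrow>\<^sub>M borel"
    using sets_PiM_equal_borel by (metis measurable_cong_sets)
  from measurable_sets[OF this borel_closed[OF closed]] show ?thesis
    by (simp add: vimage_def Int_def conj_commute)
qed

lemma prob_distr_eq: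
  assumes f: "f \<in> M \<rightarrow>\<^sub>M N" "distr M N f = N" and P: "{x \<in> space N. P x} \<in> sets N"
  shows "\<P>(x in M. P (f x)) = \<P>(x in N. P x)"
proof -
  have "f -` {x \<in> space N. P x} \<inter> space M = {x \<in> space M. P (f x)}"
    using measurable_space[OF f(1)] by auto
  then show ?thesis using measure_distr[OF f(1) P] f(2) by simp
qed

text \<open>Rotation is linear, so rotating the mean amounts to rotating mean and noise together,
  and the law of the noise does not change.\<close>

lemma offset_prob_rotate_rows:
  assumes s: "s > 0" and pq: "p < m" "q < m" "p \<noteq> q"
    and ab: "(cmod a)\<^sup>2 + (cmod b)\<^sup>2 = 1" "b \<noteq> 0"
  shows "offset_prob m n s r (rotate_rows a b p q {..<n} A) = offset_prob m n s r A"
proof -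
  have "(\<lambda>ij. rotate_rows a b p q {..<n} A ij + rotate_rows a b p q {..<n} \<omega> ij)
      = rotate_rows a b p q {..<n} (\<lambda>ij. A ij + \<omega> ij)" for \<omega>
    by (auto simp: rotate_rows_def rotate2_def fun_eq_iff algebra_simps)
  then show ?thesis
    using prob_distr_eq[OF distr_rotate_rows[OF s pq ab] sets_bilinear_bound[of m n s r "rotate_rows a b p q {..<n} A"]] bilinear_bound_rotate_rows[OF pq ab(1)]
    by (simp add: offset_prob_def)
qed

lemma bilinear_bound_transpose:
  "bilinear_bound n m r (\<lambda>(j, i). M (i, j)) \<longleftrightarrow> bilinear_bound m n r M"
proof -
  have dir: "bilinear_bound n m r (\<lambda>(j, i). M (i, j))" if "bilinear_bound m n r M" for m n M
    unfolding bilinear_bound_def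
  proof (intro allI)
    fix x y :: "nat \<Rightarrow> complex"
    show "cmod (\<Sum>j<n. \<Sum>i<m. x j * (case (j, i) of (j, i) \<Rightarrow> M (i, j)) * y i)
        \<le> r * L2_set (\<lambda>j. cmod (x j)) {..<n} * L2_set (\<lambda>i. cmod (y i)) {..<m}"
      using that[unfolded bilinear_bound_def, rule_format, of y x]
      by (subst sum.swap) (simp add: mult_ac)
  qed
  show ?thesis using dir[of m n M] dir[of n m "\<lambda>(j, i). M (i, j)"] by auto
qed

text \<open>Transposition merely reindexes an i.i.d. family. It makes row operations available for
  columns, and later it exchanges the two antenna numbers.\<close>

lemma offset_prob_transpose:
  assumes s: "s > 0"
  shows "offset_prob n m s r (\<lambda>(j, i). A (i, j)) = offset_prob m n s r A"
proof -
  let ?I = "{..<m} \<times> {..<n}" and ?J = "{..<n} \<times> {..<m}"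
  let ?f = "\<lambda>\<omega>. \<lambda>ji\<in>?J. \<omega> (prod.swap ji)"
  interpret product_prob_space "\<lambda>_ :: nat \<times> nat. cscg s" using s by (rule product_prob_space_cscg)
  have d: "distr (cscg_entries m n s) (cscg_entries n m s) ?f = cscg_entries n m s"
    unfolding cscg_entries_def by (rule distr_reorder) auto
  have m: "?f \<in> cscg_entries m n s \<rightarrow>\<^sub>M cscg_entries n m s"
    unfolding cscg_entries_def
    by (rule measurable_restrict) (auto intro!: measurable_component_singleton)
  have "bilinear_bound n m r (\<lambda>ij. (case ij of (j, i) \<Rightarrow> A (i, j)) + ?f \<omega> ij)
      \<longleftrightarrow> bilinear_bound m n r (\<lambda>ij. A ij + \<omega> ij)" for \<omega>
    by (subst bilinear_bound_transpose[symmetric], intro bilinear_bound_cong) auto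
  then show ?thesis
    using prob_distr_eq[OF m d sets_bilinear_bound[of n m s r "\<lambda>(j, i). A (i, j)"]]
    by (simp add: offset_prob_def)
qed

lemma bilinear_bound_mult_unit:
  assumes "cmod c = 1"
  shows "bilinear_bound m n r (\<lambda>ij. c * M ij) \<longleftrightarrow> bilinear_bound m n r M"
proof -
  have "(\<Sum>i<m. \<Sum>j<n. x i * (c * M (i, j)) * y j) = c * (\<Sum>i<m. \<Sum>j<n. x i * M (i, j) * y j)" for x y
    by (simp add: sum_distrib_left mult_ac)
  then show ?thesis using assms by (simp add: bilinear_bound_def norm_mult)
qed

text \<open>Used to discard the phase that remains after a rank-one mean has been rotated into one
  entry.\<close>

lemma offset_prob_mult_unit:
  assumes s: "s > 0" and c: "cmod c = 1"
  shows "offset_prob m n s r (\<lambda>ij. c * A ij) = offset_prob m n s r A"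
proof -
  let ?I = "{..<m} \<times> {..<n}" and ?E = "cscg_entries m n s"
  let ?f = "compose ?I (\<lambda>z. c * z) :: (nat \<times> nat \<Rightarrow> complex) \<Rightarrow> _"
  have pp: "product_prob_space (\<lambda>_ :: nat \<times> nat. cscg s)" using s by (rule product_prob_space_cscg)
  have mc: "(\<lambda>z. c * z) \<in> cscg s \<rightarrow>\<^sub>M cscg s"
    by (simp cong: measurable_cong_sets)
  have d: "distr ?E ?E ?f = ?E"
    unfolding cscg_entries_def
    by (subst distr_PiM_finite_prob_space[OF _ pp pp mc]) (simp_all add: distr_cscg_mult_unit[OF s c])
  have m: "?f \<in> ?E \<rightarrow>\<^sub>M ?E"
    unfolding cscg_entries_def compose_def
    by (intro measurable_restrict measurable_compose[OF _ mc] measurable_component_singleton)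
  have "bilinear_bound m n r (\<lambda>ij. c * A ij + ?f \<omega> ij) \<longleftrightarrow> bilinear_bound m n r (\<lambda>ij. A ij + \<omega> ij)" for \<omega>
    by (subst bilinear_bound_mult_unit[OF c, symmetric], intro bilinear_bound_cong)
      (auto simp: compose_def algebra_simps)
  then show ?thesis
    using prob_distr_eq[OF m d sets_bilinear_bound[of m n s r "\<lambda>ij. c * A ij"]]
    by (simp add: offset_prob_def)
qed

text \<open>Rotations of the first row with the \<open>k\<close>-th row, for decreasing \<open>k\<close>, concentrate
  \<open>x\<close> in its first entry.\<close>

lemma offset_prob_concentrate_rows:
  assumes s: "s > 0" and m: "m > 0"
  shows "\<exists>\<zeta>. cmod \<zeta> = 1 \<and> offset_prob m n s r (\<lambda>(i, j). x i * y j)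
    = offset_prob m n s r (\<lambda>(i, j). if i = 0 then \<zeta> * L2_set (\<lambda>i. cmod (x i)) {..<m} * y j else 0)"
proof -
  have "\<exists>\<zeta>. cmod \<zeta> = 1 \<and> offset_prob m n s r (\<lambda>(i, j). x i * y j)
    = offset_prob m n s r (\<lambda>(i, j). if i = 0 then \<zeta> * L2_set (\<lambda>i. cmod (x i)) {..<m} * y j else 0)"
    if "k < m" "\<And>i. k < i \<Longrightarrow> i < m \<Longrightarrow> x i = 0" for k x
    using that
  proof (induction k arbitrary: x)
    case 0
    \<comment> \<open>The phase of the remaining entry; the value 1 for a zero entry keeps
      \<open>\<zeta>\<close> of modulus 1, since \<open>sgn 0 = 0\<close>.\<close>
    define \<zeta> where "\<zeta> = (if x 0 = 0 then 1 else sgn (x 0))"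
    have "cmod \<zeta> = 1" by (simp add: \<zeta>_def norm_sgn)
    moreover have "L2_set (\<lambda>i. cmod (x i)) {..<m} = cmod (x 0)"
    proof -
      have "(\<Sum>i<m. (cmod (x i))\<^sup>2) = (\<Sum>i\<in>{0}. (cmod (x i))\<^sup>2)"
        using 0 m by (intro sum.mono_neutral_right) auto
      then show ?thesis by (simp add: L2_set_def)
    qed
    moreover have "x 0 = \<zeta> * cmod (x 0)"
      by (simp add: \<zeta>_def sgn_div_norm scaleR_conv_of_real)
    ultimately show ?case
      using 0 by (intro exI[of _ \<zeta>] conjI offset_prob_cong) auto
  next
    case (Suc k)
    show ?case
    proof (cases "x (Suc k) = 0")
      case True
      then have "x i = 0" if "k < i" "i < m" for i
        using Suc.prems(2)[of i] that by (cases "i = Suc k") auto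
      then show ?thesis using Suc.prems(1) by (intro Suc.IH) auto
    next
      case False
      define l where "l = sqrt ((cmod (x 0))\<^sup>2 + (cmod (x (Suc k)))\<^sup>2)"
      have l2: "l\<^sup>2 = (cmod (x 0))\<^sup>2 + (cmod (x (Suc k)))\<^sup>2" by (simp add: l_def)
      have l: "l > 0" using False by (auto simp: l_def intro!: add_nonneg_pos)
      \<comment> \<open>With these parameters the rotation sends the pair (x 0, x (Suc k)) to (l,
        0), so one more entry vanishes while the norm is kept.\<close>
      define a where "a = cnj (x 0) / l"
      define b where "b = cnj (x (Suc k)) / l"
      have ab: "(cmod a)\<^sup>2 + (cmod b)\<^sup>2 = 1" "b \<noteq> 0"
        using l False l2 by (auto simp: a_def b_def norm_divide power_divide simp flip: add_divide_distrib)
      define x' where "x' = rotate2 a b 0 (Suc k) x"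
      have pq: "0 < m" "Suc k < m" "0 \<noteq> Suc k" using Suc.prems m by auto
      have "(\<lambda>(i, j). x' i * y j) (i, j) = rotate_rows a b 0 (Suc k) {..<n} (\<lambda>(i, j). x i * y j) (i, j)"
        if "j < n" for i j
        using that by (simp add: rotate_rows_def x'_def rotate2_def algebra_simps)
      then have eqP: "offset_prob m n s r (\<lambda>(i, j). x i * y j) = offset_prob m n s r (\<lambda>(i, j). x' i * y j)"
        using offset_prob_rotate_rows[OF s pq ab, of n r "\<lambda>(i, j). x i * y j"]
          offset_prob_cong[of m n "\<lambda>(i, j). x' i * y j" _ s r] by metis
      have eqL: "L2_set (\<lambda>i. cmod (x' i)) {..<m} = L2_set (\<lambda>i. cmod (x i)) {..<m}"
        unfolding x'_def using pq ab(1) by (rule L2_set_rotate2)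
      have z: "x' i = 0" if "k < i" "i < m" for i
        using Suc.prems(2)[of i] that
        by (cases "i = Suc k") (auto simp: x'_def rotate2_def a_def b_def)
      from Suc.IH[of x', OF Suc_lessD[OF Suc.prems(1)] z] show ?thesis by (simp only: eqP eqL)
    qed
  qed
  from this[of "m - 1" x] m show ?thesis by auto
qed

section \<open>Reduction of a rank-one mean to a single entry\<close>

definition corner :: "real \<Rightarrow> nat \<times> nat \<Rightarrow> complex" where
  "corner c ij = (if ij = (0, 0) then complex_of_real c else 0)"

text \<open>The concentration of rows is applied twice, to \<open>x\<close> and, after
  transposition, to \<open>y\<close>. What remains is a corner entry times the product of two
  phases.\<close>

lemma offset_prob_rank_one:
  assumes s: "s > 0" and mn: "m > 0" "n > 0"
  shows "offset_prob m n s r (\<lambda>(i, j). x i * y j)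
    = offset_prob m n s r (corner (L2_set (\<lambda>i. cmod (x i)) {..<m} * L2_set (\<lambda>j. cmod (y j)) {..<n}))"
proof -
  let ?X = "L2_set (\<lambda>i. cmod (x i)) {..<m}" and ?Y = "L2_set (\<lambda>j. cmod (y j)) {..<n}"
  obtain \<zeta> where \<zeta>: "cmod \<zeta> = 1" "offset_prob m n s r (\<lambda>(i, j). x i * y j)
      = offset_prob m n s r (\<lambda>(i, j). if i = 0 then \<zeta> * ?X * y j else 0)"
    using offset_prob_concentrate_rows[OF s mn(1)] by metis
  define x' :: "nat \<Rightarrow> complex" where "x' i = (if i = 0 then \<zeta> * ?X else 0)" for i
  obtain \<xi> where \<xi>: "cmod \<xi> = 1" "offset_prob n m s r (\<lambda>(j, i). y j * x' i)
      = offset_prob n m s r (\<lambda>(j, i). if j = 0 then \<xi> * ?Y * x' i else 0)"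
    using offset_prob_concentrate_rows[OF s mn(2)] by metis
  note \<zeta>(2)
  also have "offset_prob m n s r (\<lambda>(i, j). if i = 0 then \<zeta> * ?X * y j else 0)
      = offset_prob n m s r (\<lambda>(j, i). y j * x' i)"
    by (subst offset_prob_transpose[OF s, symmetric], intro offset_prob_cong) (simp add: x'_def)
  also note \<xi>(2)
  also have "offset_prob n m s r (\<lambda>(j, i). if j = 0 then \<xi> * ?Y * x' i else 0)
      = offset_prob m n s r (\<lambda>ij. (\<xi> * \<zeta>) * corner (?X * ?Y) ij)"
    by (subst offset_prob_transpose[OF s, symmetric], intro offset_prob_cong)
      (simp add: x'_def corner_def)
  also have "\<dots> = offset_prob m n s r (corner (?X * ?Y))"
    using \<zeta>(1) \<xi>(1) by (intro offset_prob_mult_unit[OF s]) (simp add: norm_mult)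
  finally show ?thesis .
qed

section \<open>Large deviations\<close>

text \<open>Exponential tilting: the weighted density is 1 / (1 - t) times the density of the same
  Gaussian type with variance s^2 / (1 - t).\<close>

lemma nn_integral_exp_cscg:
  assumes s: "s > 0" and t: "t < 1"
  shows "(\<integral>\<^sup>+z. ennreal (exp (t * (cmod z)\<^sup>2 / s\<^sup>2)) \<partial>cscg s) = ennreal (1 / (1 - t))"
proof -
  define s' where "s' = s / sqrt (1 - t)"
  have s': "s' > 0" using s t by (simp add: s'_def)
  have s'2: "s'\<^sup>2 = s\<^sup>2 / (1 - t)" using t by (simp add: s'_def power_divide)
  have dens: "cscg_density s z * exp (t * (cmod z)\<^sup>2 / s\<^sup>2) = 1 / (1 - t) * cscg_density s' z" for z
  proof -
    have "exp (- (cmod z)\<^sup>2 / s\<^sup>2) * exp (t * (cmod z)\<^sup>2 / s\<^sup>2) = exp (- (cmod z)\<^sup>2 / s'\<^sup>2)"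
      using t by (simp add: s'2 algebra_simps diff_divide_distrib flip: exp_add)
    moreover have "1 / (pi * s\<^sup>2) = 1 / (1 - t) * (1 / (pi * s'\<^sup>2))"
      using t by (simp add: s'2)
    moreover have "cscg_density s z * exp (t * (cmod z)\<^sup>2 / s\<^sup>2)
        = exp (- (cmod z)\<^sup>2 / s\<^sup>2) * exp (t * (cmod z)\<^sup>2 / s\<^sup>2) * (1 / (pi * s\<^sup>2))"
      by (simp add: cscg_density_def)
    ultimately have "cscg_density s z * exp (t * (cmod z)\<^sup>2 / s\<^sup>2)
        = exp (- (cmod z)\<^sup>2 / s'\<^sup>2) * (1 / (1 - t) * (1 / (pi * s'\<^sup>2)))"
      by (simp only:)
    then show ?thesis by (simp add: cscg_density_def)
  qed
  have "(\<integral>\<^sup>+z. ennreal (exp (t * (cmod z)\<^sup>2 / s\<^sup>2)) \<partial>cscg s)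
      = (\<integral>\<^sup>+z. ennreal (1 / (1 - t)) * ennreal (cscg_density s' z) \<partial>lborel)"
    unfolding cscg_eq_density[OF s] using t
    by (subst nn_integral_density)
      (auto simp: dens cscg_density_nonneg simp flip: ennreal_mult)
  also have "\<dots> = ennreal (1 / (1 - t)) * (\<integral>\<^sup>+z. ennreal (cscg_density s' z) \<partial>lborel)"
    by (rule nn_integral_cmult) simp
  also have "(\<integral>\<^sup>+z. ennreal (cscg_density s' z) \<partial>lborel) = emeasure (cscg s') UNIV"
    unfolding cscg_eq_density[OF s'] by (simp add: emeasure_density)
  also have "\<dots> = 1"
    using prob_space.emeasure_space_1[OF prob_space_cscg[OF s']] by simp
  finally show ?thesis by simp
qed

abbreviation frob :: "nat \<Rightarrow> nat \<Rightarrow> (nat \<times> nat \<Rightarrow> complex) \<Rightarrow> real" where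
  "frob m n M \<equiv> L2_set (\<lambda>ij. cmod (M ij)) ({..<m} \<times> {..<n})"

text \<open>Markov's inequality for exp (t * |M|^2 / s^2), with |M| the Frobenius norm; by
  independence its expectation is a product of \<open>m * n\<close> equal factors. That product does
  not depend on \<open>s\<close>, so it is harmless as \<open>s\<close> tends to 0.\<close>

lemma cscg_entries_chernoff:
  assumes s: "s > 0" and t: "0 < t" "t < 1" and x: "x \<ge> 0"
    and E: "E \<in> sets (cscg_entries m n s)" "\<And>\<omega>. \<omega> \<in> E \<Longrightarrow> x \<le> frob m n \<omega>"
  shows "measure (cscg_entries m n s) E \<le> exp (- t * x\<^sup>2 / s\<^sup>2) * (1 / (1 - t)) ^ (m * n)"
proof -
  let ?I = "{..<m} \<times> {..<n}" and ?E = "cscg_entries m n s"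
  interpret product_prob_space "\<lambda>_ :: nat \<times> nat. cscg s" using s by (rule product_prob_space_cscg)
  interpret E: prob_space ?E using s by (rule prob_space_cscg_entries)
  define e where "e z = exp (t * (cmod z)\<^sup>2 / s\<^sup>2)" for z :: complex
  define u where "u \<omega> = (\<Prod>ij\<in>?I. ennreal (e (\<omega> ij)))" for \<omega> :: "nat \<times> nat \<Rightarrow> complex"
  define c where "c = exp (- (t * x\<^sup>2 / s\<^sup>2))"
  have e: "(\<lambda>z. ennreal (e z)) \<in> borel_measurable (cscg s)"
    unfolding e_def by measurable
  have u [measurable]: "u \<in> borel_measurable ?E"
    unfolding cscg_entries_def u_def
    by (intro borel_measurable_prod_ennreal measurable_compose[OF _ e] measurable_component_singleton)
  have "(\<integral>\<^sup>+\<omega>. u \<omega> \<partial>?E) = (\<Prod>ij\<in>?I. \<integral>\<^sup>+z. ennreal (e z) \<partial>cscg s)"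
    unfolding cscg_entries_def u_def by (rule product_nn_integral_prod) (use e in auto)
  also have "\<dots> = (\<Prod>ij\<in>?I. ennreal (1 / (1 - t)))"
    unfolding e_def nn_integral_exp_cscg[OF s t(2)] ..
  also have "\<dots> = ennreal ((1 / (1 - t)) ^ (m * n))"
    using t by (subst prod_ennreal) (simp_all add: card_cartesian_product)
  finally have int: "(\<integral>\<^sup>+\<omega>. u \<omega> \<partial>?E) = ennreal ((1 / (1 - t)) ^ (m * n))" .
  have "E \<subseteq> {\<omega> \<in> space ?E. 1 \<le> ennreal c * u \<omega>}"
  proof
    fix \<omega> assume \<omega>: "\<omega> \<in> E"
    have "x\<^sup>2 \<le> (frob m n \<omega>)\<^sup>2" using E(2)[OF \<omega>] x by (intro power_mono)
    also have "\<dots> = (\<Sum>ij\<in>?I. (cmod (\<omega> ij))\<^sup>2)" by (simp add: L2_set_def sum_nonneg)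
    finally have "t * x\<^sup>2 / s\<^sup>2 \<le> t * (\<Sum>ij\<in>?I. (cmod (\<omega> ij))\<^sup>2) / s\<^sup>2"
      using t by (intro divide_right_mono mult_left_mono) auto
    also have "\<dots> = (\<Sum>ij\<in>?I. t * (cmod (\<omega> ij))\<^sup>2 / s\<^sup>2)"
      by (simp only: sum_distrib_left sum_divide_distrib)
    finally have le: "exp (t * x\<^sup>2 / s\<^sup>2) \<le> (\<Prod>ij\<in>?I. e (\<omega> ij))"
      unfolding e_def by (subst exp_sum[symmetric]) simp_all
    have "1 = c * exp (t * x\<^sup>2 / s\<^sup>2)"
      unfolding c_def by (simp flip: exp_add)
    also have "\<dots> \<le> c * (\<Prod>ij\<in>?I. e (\<omega> ij))"
      by (intro mult_left_mono le) (simp add: c_def)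
    finally have "ennreal 1 \<le> ennreal (c * (\<Prod>ij\<in>?I. e (\<omega> ij)))"
      by (rule ennreal_leI)
    also have "\<dots> = ennreal c * u \<omega>"
      unfolding u_def by (subst prod_ennreal) (auto simp: e_def c_def ennreal_mult prod_nonneg)
    finally show "\<omega> \<in> {\<omega> \<in> space ?E. 1 \<le> ennreal c * u \<omega>}"
      using \<omega> sets.sets_into_space[OF E(1)] by auto
  qed
  then have "emeasure ?E E \<le> emeasure ?E {\<omega> \<in> space ?E. 1 \<le> ennreal c * u \<omega>}"
    by (intro emeasure_mono) measurable
  also have "\<dots> \<le> ennreal c * (\<integral>\<^sup>+\<omega>. u \<omega> * indicator (space ?E) \<omega> \<partial>?E)"
    by (intro nn_integral_Markov_inequality) auto
  also have "(\<integral>\<^sup>+\<omega>. u \<omega> * indicator (space ?E) \<omega> \<partial>?E) = (\<integral>\<^sup>+\<omega>. u \<omega> \<partial>?E)"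
    by (intro nn_integral_cong) simp
  also have "ennreal c * (\<integral>\<^sup>+\<omega>. u \<omega> \<partial>?E) = ennreal (c * (1 / (1 - t)) ^ (m * n))"
    unfolding int using t by (subst ennreal_mult) (auto simp: c_def)
  finally have "ennreal (measure ?E E) \<le> ennreal (c * (1 / (1 - t)) ^ (m * n))"
    by (simp add: E.emeasure_eq_measure)
  then have "measure ?E E \<le> c * (1 / (1 - t)) ^ (m * n)"
    using t by (subst (asm) ennreal_le_iff) (auto simp: c_def)
  then show ?thesis by (simp add: c_def)
qed

lemma eventually_le_exp_divide_square:
  fixes k C :: real
  assumes "k > 0"
  shows "\<forall>\<^sub>F s in at_right 0. C \<le> exp (k / s\<^sup>2)"
proof -
  have "filterlim (\<lambda>s. k / s\<^sup>2) at_top (at_right 0)"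
    using assms by real_asymp
  then have "filterlim (\<lambda>s. exp (k / s\<^sup>2)) at_top (at_right 0)"
    by (rule filterlim_compose[OF exp_at_top])
  then show ?thesis by (simp add: filterlim_at_top)
qed

text \<open>The two halves of a large deviation principle with rate function \<open>M \<mapsto> frob m n M ^ 2\<close>
  and speed \<open>1 / s ^ 2\<close>.\<close>

lemma cscg_entries_upper:
  assumes Q: "Q < x\<^sup>2" and x: "x > 0"
  shows "\<forall>\<^sub>F s in at_right 0. \<forall>E \<in> sets (cscg_entries m n s).
    (\<forall>\<omega>\<in>E. x \<le> frob m n \<omega>) \<longrightarrow> measure (cscg_entries m n s) E \<le> exp (- Q / s\<^sup>2)"
proof -
  \<comment> \<open>\<open>t\<close> is taken so close to 1 that t * x^2 still exceeds
    \<open>Q\<close>; the slack absorbs the prefactor of the Chernoff bound. The maximum with 0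
    keeps \<open>t\<close> positive when \<open>Q\<close> is negative.\<close>
  have "max 0 (Q / x\<^sup>2) < 1" using Q x by (simp add: field_simps)
  then obtain t where "max 0 (Q / x\<^sup>2) < t" "t < 1" using dense by blast
  then have t: "0 < t" "t < 1" "Q / x\<^sup>2 < t" by auto
  have k: "t * x\<^sup>2 - Q > 0" using t(3) x by (simp add: field_simps)
  have "\<forall>\<^sub>F s in at_right 0. (1 / (1 - t)) ^ (m * n) \<le> exp ((t * x\<^sup>2 - Q) / s\<^sup>2)"
    by (rule eventually_le_exp_divide_square[OF k])
  moreover have "\<forall>\<^sub>F s :: real in at_right 0. s > 0" by (rule eventually_at_right_less)
  ultimately show ?thesis
  proof eventually_elim
    fix s :: real
    assume C: "(1 / (1 - t)) ^ (m * n) \<le> exp ((t * x\<^sup>2 - Q) / s\<^sup>2)" and s: "0 < s"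
    have "exp (- t * x\<^sup>2 / s\<^sup>2) * (1 / (1 - t)) ^ (m * n)
        \<le> exp (- t * x\<^sup>2 / s\<^sup>2) * exp ((t * x\<^sup>2 - Q) / s\<^sup>2)"
      using C by (intro mult_left_mono) auto
    also have "\<dots> = exp (- Q / s\<^sup>2)"
      by (simp add: diff_divide_distrib flip: exp_add)
    finally show "\<forall>E \<in> sets (cscg_entries m n s).
        (\<forall>\<omega>\<in>E. x \<le> frob m n \<omega>) \<longrightarrow> measure (cscg_entries m n s) E \<le> exp (- Q / s\<^sup>2)"
      using cscg_entries_chernoff[OF s t(1,2), of x _ m n] x by (meson less_imp_le order_trans)
  qed
qed

text \<open>On the disc the density is at least exp (- (|h| + d)^2 / s^2) / (pi * s^2), and the area
  is pi * d^2. The remaining factor d^2 / s^2 is at least 1 because \<open>s\<close> does not exceed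
  \<open>d\<close>.\<close>

lemma emeasure_cscg_cball:
  assumes s: "0 < s" "s \<le> d"
  shows "ennreal (exp (- (cmod h + d)\<^sup>2 / s\<^sup>2)) \<le> emeasure (cscg s) (cball h d)"
proof -
  let ?k = "exp (- (cmod h + d)\<^sup>2 / s\<^sup>2) / (pi * s\<^sup>2)"
  have "exp (- (cmod h + d)\<^sup>2 / s\<^sup>2) * 1 \<le> exp (- (cmod h + d)\<^sup>2 / s\<^sup>2) * (d\<^sup>2 / s\<^sup>2)"
    using s by (intro mult_left_mono) (auto simp: field_simps power_mono)
  also have "\<dots> = ?k * (pi * d\<^sup>2)" by simp
  finally have "ennreal (exp (- (cmod h + d)\<^sup>2 / s\<^sup>2)) \<le> ennreal ?k * ennreal (pi * d\<^sup>2)"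
    by (simp add: ennreal_leI flip: ennreal_mult)
  also have "ennreal (pi * d\<^sup>2) = emeasure lborel (cball h d)"
    using s by (subst emeasure_cball) (auto simp: unit_ball_vol_2)
  also have "ennreal ?k * emeasure lborel (cball h d) = (\<integral>\<^sup>+z. ennreal ?k * indicator (cball h d) z \<partial>lborel)"
    by (simp add: nn_integral_cmult_indicator)
  also have "\<dots> \<le> (\<integral>\<^sup>+z. ennreal (cscg_density s z) * indicator (cball h d) z \<partial>lborel)"
  proof (intro nn_integral_mono)
    fix z
    have "?k \<le> cscg_density s z" if "z \<in> cball h d"
    proof -
      have "cmod z \<le> cmod h + d"
        using that norm_triangle_ineq2[of z h] by (simp add: dist_norm norm_minus_commute)
      then have "(cmod z)\<^sup>2 / s\<^sup>2 \<le> (cmod h + d)\<^sup>2 / s\<^sup>2"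
        by (intro divide_right_mono power_mono) auto
      then show ?thesis
        unfolding cscg_density_def by (intro divide_right_mono) auto
    qed
    then show "ennreal ?k * indicator (cball h d) z \<le> ennreal (cscg_density s z) * indicator (cball h d) z"
      by (auto split: split_indicator intro: ennreal_leI)
  qed
  also have "\<dots> = emeasure (cscg s) (cball h d)"
    unfolding cscg_eq_density[OF s(1)] by (simp add: emeasure_density)
  finally show ?thesis .
qed

lemma cscg_entries_lower:
  assumes Q: "(frob m n H)\<^sup>2 < Q" and \<epsilon>: "\<epsilon> > 0"
  shows "\<forall>\<^sub>F s in at_right 0. \<forall>E \<in> sets (cscg_entries m n s).
    (\<forall>\<omega> \<in> space (cscg_entries m n s). frob m n (\<lambda>ij. \<omega> ij - H ij) \<le> \<epsilon> \<longrightarrow> \<omega> \<in> E)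
      \<longrightarrow> exp (- Q / s\<^sup>2) \<le> measure (cscg_entries m n s) E"
proof -
  let ?I = "{..<m} \<times> {..<n}"
  \<comment> \<open>\<open>d\<close> will be the radius of discs around the entries of
    \<open>H\<close>. It must keep the total cost below \<open>Q\<close> and the product of the
    discs within Frobenius distance \<open>\<epsilon>\<close> of \<open>H\<close>; both hold
    strictly at 0 and persist by continuity.\<close>
  have "((\<lambda>d. \<Sum>ij\<in>?I. (cmod (H ij) + d)\<^sup>2) \<longlongrightarrow> (\<Sum>ij\<in>?I. (cmod (H ij) + 0)\<^sup>2)) (at_right 0)"
    by (intro tendsto_intros)
  moreover have "(\<Sum>ij\<in>?I. (cmod (H ij) + 0)\<^sup>2) < Q"
    using Q by (simp add: L2_set_def sum_nonneg)
  ultimately have "\<forall>\<^sub>F d in at_right 0. (\<Sum>ij\<in>?I. (cmod (H ij) + d)\<^sup>2) < Q"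
    by (rule order_tendstoD(2))
  moreover have "((\<lambda>d. frob m n (\<lambda>_. complex_of_real d)) \<longlongrightarrow> frob m n (\<lambda>_. complex_of_real 0)) (at_right 0)"
    unfolding L2_set_def by (intro tendsto_intros)
  then have "\<forall>\<^sub>F d in at_right 0. frob m n (\<lambda>_. complex_of_real d) < \<epsilon>"
    using \<epsilon> by (intro order_tendstoD(2)) (auto simp: L2_set_def)
  moreover have "\<forall>\<^sub>F d :: real in at_right 0. d > 0" by (rule eventually_at_right_less)
  ultimately have "\<forall>\<^sub>F d in at_right 0. (\<Sum>ij\<in>?I. (cmod (H ij) + d)\<^sup>2) < Q
      \<and> frob m n (\<lambda>_. complex_of_real d) < \<epsilon> \<and> d > 0"
    by eventually_elim auto
  then obtain d where d: "(\<Sum>ij\<in>?I. (cmod (H ij) + d)\<^sup>2) < Q"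
      "frob m n (\<lambda>_. complex_of_real d) < \<epsilon>" "d > 0"
    using eventually_happens'[OF trivial_limit_at_right_real[of "0 :: real"]] by blast
  have "\<forall>\<^sub>F s in at_right 0. s < d" using d(3) by (rule eventually_at_right_field[THEN iffD2, OF exI, OF conjI]) auto
  moreover have "\<forall>\<^sub>F s :: real in at_right 0. s > 0" by (rule eventually_at_right_less)
  ultimately show ?thesis
  proof eventually_elim
    fix s :: real
    assume s: "s < d" "0 < s"
    let ?E = "cscg_entries m n s"
    interpret product_prob_space "\<lambda>_ :: nat \<times> nat. cscg s" using s(2) by (rule product_prob_space_cscg)
    interpret E: prob_space ?E using s(2) by (rule prob_space_cscg_entries)
    show "\<forall>E \<in> sets ?E. (\<forall>\<omega> \<in> space ?E. frob m n (\<lambda>ij. \<omega> ij - H ij) \<le> \<epsilon> \<longrightarrow> \<omega> \<in> E)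
        \<longrightarrow> exp (- Q / s\<^sup>2) \<le> measure ?E E"
    proof (intro ballI impI)
      fix E assume E: "E \<in> sets ?E" "\<forall>\<omega> \<in> space ?E. frob m n (\<lambda>ij. \<omega> ij - H ij) \<le> \<epsilon> \<longrightarrow> \<omega> \<in> E"
      let ?B = "\<Pi>\<^sub>E ij\<in>?I. cball (H ij) d"
      have "?B \<subseteq> E"
      proof
        fix \<omega> assume \<omega>: "\<omega> \<in> ?B"
        have "frob m n (\<lambda>ij. \<omega> ij - H ij) \<le> frob m n (\<lambda>_. complex_of_real d)"
          using \<omega> d(3) by (intro L2_set_mono) (auto simp: PiE_iff dist_norm norm_minus_commute)
        moreover have "\<omega> \<in> space ?E"
          using \<omega> by (auto simp: cscg_entries_def space_PiM PiE_iff)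
        ultimately show "\<omega> \<in> E" using E(2) d(2) by auto
      qed
      have "ennreal (exp (- Q / s\<^sup>2)) \<le> ennreal (\<Prod>ij\<in>?I. exp (- (cmod (H ij) + d)\<^sup>2 / s\<^sup>2))"
      proof (rule ennreal_leI)
        have "exp (- Q / s\<^sup>2) \<le> exp (- (\<Sum>ij\<in>?I. (cmod (H ij) + d)\<^sup>2) / s\<^sup>2)"
          using d(1) by (simp add: divide_right_mono)
        also have "\<dots> = (\<Prod>ij\<in>?I. exp (- (cmod (H ij) + d)\<^sup>2 / s\<^sup>2))"
          by (simp add: sum_divide_distrib sum_negf flip: exp_sum)
        finally show "exp (- Q / s\<^sup>2) \<le> (\<Prod>ij\<in>?I. exp (- (cmod (H ij) + d)\<^sup>2 / s\<^sup>2))" .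
      qed
      also have "\<dots> = (\<Prod>ij\<in>?I. ennreal (exp (- (cmod (H ij) + d)\<^sup>2 / s\<^sup>2)))"
        by (rule prod_ennreal[symmetric]) simp
      also have "\<dots> \<le> (\<Prod>ij\<in>?I. emeasure (cscg s) (cball (H ij) d))"
        using s by (intro prod_mono_ennreal emeasure_cscg_cball) auto
      also have "\<dots> = emeasure ?E ?B"
        unfolding cscg_entries_def by (rule emeasure_PiM[symmetric]) auto
      also have "\<dots> \<le> emeasure ?E E"
        using \<open>?B \<subseteq> E\<close> E(1) by (rule emeasure_mono)
      finally show "exp (- Q / s\<^sup>2) \<le> measure ?E E"
        by (simp add: E.emeasure_eq_measure)
    qed
  qed
qed

section \<open>Outage probabilities\<close>

lemma bilinear_bound_corner_entry:
  assumes "bilinear_bound m n r M" "m > 0" "n > 0"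
  shows "cmod (M (0, 0)) \<le> r"
proof -
  let ?e = "\<lambda>i :: nat. if i = 0 then 1 else 0 :: complex"
  have "L2_set (\<lambda>i. cmod (?e i)) {..<k} = 1" if "k > 0" for k
  proof -
    have "(\<Sum>i<k. (cmod (?e i))\<^sup>2) = (\<Sum>i\<in>{0}. (cmod (?e i))\<^sup>2)"
      using that by (intro sum.mono_neutral_right) auto
    then show ?thesis by (simp add: L2_set_def)
  qed
  moreover have "(\<Sum>i<m. \<Sum>j<n. ?e i * M (i, j) * ?e j) = M (0, 0)"
  proof -
    have "(\<Sum>i<m. \<Sum>j<n. ?e i * M (i, j) * ?e j) = (\<Sum>i\<in>{0}. \<Sum>j<n. ?e i * M (i, j) * ?e j)"
      using assms by (intro sum.mono_neutral_right) auto
    also have "(\<Sum>j<n. ?e 0 * M (0, j) * ?e j) = (\<Sum>j\<in>{0}. ?e 0 * M (0, j) * ?e j)"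
      using assms by (intro sum.mono_neutral_right) auto
    then have "(\<Sum>i\<in>{0}. \<Sum>j<n. ?e i * M (i, j) * ?e j) = M (0, 0)" by simp
    finally show ?thesis .
  qed
  ultimately show ?thesis
    using assms(1)[unfolded bilinear_bound_def, rule_format, of ?e ?e] assms by simp
qed

text \<open>Cauchy-Schwarz over index pairs; the family of products of the entries of
  \<open>x\<close> and \<open>y\<close> has norm |x| * |y|.\<close>

lemma bilinear_bound_frob: "bilinear_bound m n (frob m n M) M"
  unfolding bilinear_bound_def
proof (intro allI)
  fix x y :: "nat \<Rightarrow> complex"
  let ?I = "{..<m} \<times> {..<n}"
  have "(\<Sum>i<m. \<Sum>j<n. x i * M (i, j) * y j) = (\<Sum>ij\<in>?I. M ij * (x (fst ij) * y (snd ij)))"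
    by (simp add: sum.cartesian_product case_prod_unfold mult_ac)
  moreover have "L2_set (\<lambda>ij. cmod (x (fst ij) * y (snd ij))) ?I
      = L2_set (\<lambda>i. cmod (x i)) {..<m} * L2_set (\<lambda>j. cmod (y j)) {..<n}"
    by (simp add: L2_set_def sum_product sum.cartesian_product case_prod_unfold norm_mult
        power_mult_distrib flip: real_sqrt_mult)
  ultimately show "cmod (\<Sum>i<m. \<Sum>j<n. x i * M (i, j) * y j)
      \<le> frob m n M * L2_set (\<lambda>i. cmod (x i)) {..<m} * L2_set (\<lambda>j. cmod (y j)) {..<n}"
    using norm_sum_mult_le_L2_set[of M "\<lambda>ij. x (fst ij) * y (snd ij)" ?I] by (simp add: mult.assoc)
qed

lemma bilinear_bound_add:
  assumes "bilinear_bound m n r M" "bilinear_bound m n r' M'"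
  shows "bilinear_bound m n (r + r') (\<lambda>ij. M ij + M' ij)"
  unfolding bilinear_bound_def
proof (intro allI)
  fix x y :: "nat \<Rightarrow> complex"
  let ?S = "\<lambda>M. \<Sum>i<m. \<Sum>j<n. x i * M (i, j) * y j"
  have "?S (\<lambda>ij. M ij + M' ij) = ?S M + ?S M'"
    by (simp add: distrib_left distrib_right sum.distrib)
  then have "cmod (?S (\<lambda>ij. M ij + M' ij)) \<le> cmod (?S M) + cmod (?S M')"
    by (simp add: norm_triangle_ineq)
  also have "\<dots> \<le> r * L2_set (\<lambda>i. cmod (x i)) {..<m} * L2_set (\<lambda>j. cmod (y j)) {..<n}
      + r' * L2_set (\<lambda>i. cmod (x i)) {..<m} * L2_set (\<lambda>j. cmod (y j)) {..<n}"
    using assms unfolding bilinear_bound_def by (intro add_mono) auto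
  finally show "cmod (?S (\<lambda>ij. M ij + M' ij))
      \<le> (r + r') * L2_set (\<lambda>i. cmod (x i)) {..<m} * L2_set (\<lambda>j. cmod (y j)) {..<n}"
    by (simp add: distrib_right)
qed

lemma bilinear_bound_mono:
  assumes "bilinear_bound m n r M" "r \<le> r'"
  shows "bilinear_bound m n r' M"
  unfolding bilinear_bound_def
proof (intro allI)
  fix x y :: "nat \<Rightarrow> complex"
  let ?X = "L2_set (\<lambda>i. cmod (x i)) {..<m}" and ?Y = "L2_set (\<lambda>j. cmod (y j)) {..<n}"
  have "cmod (\<Sum>i<m. \<Sum>j<n. x i * M (i, j) * y j) \<le> r * ?X * ?Y"
    using assms(1) by (simp add: bilinear_bound_def)
  also have "\<dots> \<le> r' * ?X * ?Y"
    using assms(2) by (intro mult_right_mono) (simp_all add: L2_set_nonneg)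
  finally show "cmod (\<Sum>i<m. \<Sum>j<n. x i * M (i, j) * y j) \<le> r' * ?X * ?Y" .
qed

lemma frob_corner:
  assumes "m > 0" "n > 0"
  shows "frob m n (corner c) = \<bar>c\<bar>"
proof -
  have "(\<Sum>ij\<in>{..<m} \<times> {..<n}. (cmod (corner c ij))\<^sup>2) = (\<Sum>ij\<in>{(0, 0)}. (cmod (corner c ij))\<^sup>2)"
    using assms by (intro sum.mono_neutral_right) (auto simp: corner_def)
  then show ?thesis by (simp add: L2_set_def corner_def)
qed

lemma norm_entry_le_frob:
  assumes "i < m" "j < n"
  shows "cmod (M (i, j)) \<le> frob m n M"
  using member_le_L2_set[of "{..<m} \<times> {..<n}" "(i, j)" "\<lambda>ij. cmod (M ij)"] assms by simp

text \<open>Reaching the ball of radius \<open>r\<close> from \<open>corner c\<close> (or leaving it) costs a perturbation of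
  Frobenius norm at least \<open>\<bar>c - r\<bar>\<close>, and arbitrarily little more than this suffices.\<close>

lemma eventually_offset_prob_corner_le:
  assumes pos: "m > 0" "n > 0" "m' > 0" "n' > 0" and r: "r > 0" and c: "0 \<le> c" "c < c'"
  shows "\<forall>\<^sub>F s in at_right 0. offset_prob m' n' s r (corner c') \<le> offset_prob m n s r (corner c)"
proof -
  let ?B = "\<lambda>m n c \<omega>. bilinear_bound m n r (\<lambda>ij. corner c ij + \<omega> ij)"
  show ?thesis
  proof (cases "c' > r")
    case True
    \<comment> \<open>Here the mean \<open>c'\<close> lies outside the ball. A shift by -d must put
      the mean \<open>c\<close> strictly inside, |c - d| < r, at a cost strictly below that of
      bringing \<open>c'\<close> to the ball, |d| < c' - r. These are two open intervals for
      \<open>d\<close>, and \<open>lo\<close> and \<open>hi\<close> are the ends of their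
      intersection. This treats \<open>c\<close> inside and outside the ball alike.\<close>
    define lo where "lo = max (c - r) (r - c')"
    define hi where "hi = min (c + r) (c' - r)"
    have "lo < hi" using True r c by (auto simp: lo_def hi_def)
    then obtain d where "lo < d" "d < hi" using dense by blast
    then have d: "\<bar>c - d\<bar> < r" "\<bar>d\<bar> < c' - r" by (auto simp: lo_def hi_def)
    have "d\<^sup>2 < (c' - r)\<^sup>2" using d(2) by (metis abs_ge_zero power2_abs power_strict_mono zero_less_numeral)
    then obtain Q where Q: "d\<^sup>2 < Q" "Q < (c' - r)\<^sup>2" using dense by blast
    have Q1: "(frob m n (corner (- d)))\<^sup>2 < Q" using Q(1) pos by (simp add: frob_corner)
    have "r - \<bar>c - d\<bar> > 0" "c' - r > 0" using d True by auto
    from cscg_entries_lower[OF Q1 this(1)] cscg_entries_upper[OF Q(2) this(2), of m' n']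
    show ?thesis
    proof eventually_elim
      fix s
      let ?E = "{\<omega> \<in> space (cscg_entries m n s). ?B m n c \<omega>}"
      let ?E' = "{\<omega> \<in> space (cscg_entries m' n' s). ?B m' n' c' \<omega>}"
      assume lower: "\<forall>E \<in> sets (cscg_entries m n s).
          (\<forall>\<omega> \<in> space (cscg_entries m n s). frob m n (\<lambda>ij. \<omega> ij - corner (- d) ij) \<le> r - \<bar>c - d\<bar> \<longrightarrow> \<omega> \<in> E)
          \<longrightarrow> exp (- Q / s\<^sup>2) \<le> measure (cscg_entries m n s) E"
        and upper: "\<forall>E \<in> sets (cscg_entries m' n' s). (\<forall>\<omega>\<in>E. c' - r \<le> frob m' n' \<omega>)
          \<longrightarrow> measure (cscg_entries m' n' s) E \<le> exp (- Q / s\<^sup>2)"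
      \<comment> \<open>The norm of the shifted corner is |c - d|, and the rest may use up the whole
        remaining margin up to \<open>r\<close>, because outage is a non-strict inequality.\<close>
      have "?B m n c \<omega>" if "frob m n (\<lambda>ij. \<omega> ij - corner (- d) ij) \<le> r - \<bar>c - d\<bar>" for \<omega>
      proof -
        have "bilinear_bound m n (\<bar>c - d\<bar> + (r - \<bar>c - d\<bar>)) (\<lambda>ij. corner (c - d) ij + (\<omega> ij - corner (- d) ij))"
          using bilinear_bound_frob[of m n "corner (c - d)"] pos that
          by (intro bilinear_bound_add bilinear_bound_mono[OF bilinear_bound_frob that]) (simp add: frob_corner)
        moreover have "corner (c - d) ij + (\<omega> ij - corner (- d) ij) = corner c ij + \<omega> ij" for ij
          by (simp add: corner_def)
        ultimately show ?thesis by simp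
      qed
      then have "exp (- Q / s\<^sup>2) \<le> measure (cscg_entries m n s) ?E"
        by (intro lower[rule_format] sets_bilinear_bound) auto
      moreover have "c' - r \<le> frob m' n' \<omega>" if "?B m' n' c' \<omega>" for \<omega>
      proof -
        have "cmod (complex_of_real c' + \<omega> (0, 0)) \<le> r"
          using bilinear_bound_corner_entry[OF that pos(3,4)] by (simp add: corner_def)
        moreover have "cmod (complex_of_real c') - cmod (\<omega> (0, 0)) \<le> cmod (complex_of_real c' + \<omega> (0, 0))"
          by (metis add_diff_cancel norm_minus_commute norm_triangle_ineq2 norm_diff_ineq)
        ultimately show ?thesis
          using norm_entry_le_frob[OF pos(3,4), of \<omega>] c by simp
      qed
      then have "measure (cscg_entries m' n' s) ?E' \<le> exp (- Q / s\<^sup>2)"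
        by (intro upper[rule_format] sets_bilinear_bound) auto
      ultimately show "offset_prob m' n' s r (corner c') \<le> offset_prob m n s r (corner c)"
        by (simp add: offset_prob_def)
    qed
  next
    case False
    then have c'r: "c' \<le> r" by simp
    \<comment> \<open>Now the complements are compared: a shift by \<open>d\<close> pushes
      \<open>c'\<close> out of the ball, yet costs strictly less than pushing \<open>c\<close> to
      its boundary. If \<open>c' = r\<close>, non-outage at \<open>c'\<close> need not be rare, but
      the lower bound on it still suffices.\<close>
    obtain d where d: "r - c' < d" "d < r - c" using c(2) dense[of "r - c'" "r - c"] by auto
    have "d\<^sup>2 < (r - c)\<^sup>2" using d c'r by (intro power_strict_mono) auto
    then obtain Q where Q: "d\<^sup>2 < Q" "Q < (r - c)\<^sup>2" using dense by blast
    have Q1: "(frob m' n' (corner d))\<^sup>2 < Q" using Q(1) pos by (simp add: frob_corner)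
    \<comment> \<open>Half of the excess of c' + d over \<open>r\<close> is used as tolerance, so
      that perturbed matrices stay strictly outside the ball.\<close>
    have "(c' + d - r) / 2 > 0" "r - c > 0" using d c'r c by auto
    from cscg_entries_lower[OF Q1 this(1)] cscg_entries_upper[OF Q(2) this(2), of m n]
      eventually_at_right_less[of "0 :: real"]
    show ?thesis
    proof eventually_elim
      fix s :: real
      let ?E = "{\<omega> \<in> space (cscg_entries m n s). \<not> ?B m n c \<omega>}"
      let ?E' = "{\<omega> \<in> space (cscg_entries m' n' s). \<not> ?B m' n' c' \<omega>}"
      assume lower: "\<forall>E \<in> sets (cscg_entries m' n' s).
          (\<forall>\<omega> \<in> space (cscg_entries m' n' s). frob m' n' (\<lambda>ij. \<omega> ij - corner d ij) \<le> (c' + d - r) / 2 \<longrightarrow> \<omega> \<in> E)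
          \<longrightarrow> exp (- Q / s\<^sup>2) \<le> measure (cscg_entries m' n' s) E"
        and upper: "\<forall>E \<in> sets (cscg_entries m n s). (\<forall>\<omega>\<in>E. r - c \<le> frob m n \<omega>)
          \<longrightarrow> measure (cscg_entries m n s) E \<le> exp (- Q / s\<^sup>2)"
        and s: "0 < s"
      have meas: "?E \<in> sets (cscg_entries m n s)" "?E' \<in> sets (cscg_entries m' n' s)"
        by (intro sets.sets_Collect_neg sets_bilinear_bound)+
      have "\<not> ?B m' n' c' \<omega>" if "frob m' n' (\<lambda>ij. \<omega> ij - corner d ij) \<le> (c' + d - r) / 2" for \<omega>
      proof
        assume "?B m' n' c' \<omega>"
        then have "cmod (complex_of_real c' + \<omega> (0, 0)) \<le> r"
          using bilinear_bound_corner_entry[OF _ pos(3,4)] by (fastforce simp: corner_def)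
        moreover have "cmod (\<omega> (0, 0) - complex_of_real d) \<le> (c' + d - r) / 2"
          using norm_entry_le_frob[OF pos(3,4), of "\<lambda>ij. \<omega> ij - corner d ij"] that by (simp add: corner_def)
        ultimately have "cmod ((complex_of_real c' + \<omega> (0, 0)) - (\<omega> (0, 0) - complex_of_real d))
            \<le> r + (c' + d - r) / 2"
          by (rule order_trans[OF norm_triangle_ineq4 add_mono])
        also have "(complex_of_real c' + \<omega> (0, 0)) - (\<omega> (0, 0) - complex_of_real d) = complex_of_real (c' + d)"
          by simp
        finally have "\<bar>c' + d\<bar> \<le> r + (c' + d - r) / 2"
          by (simp only: norm_of_real)
        then have "c' + d \<le> r + (c' + d - r) / 2"
          by (rule order_trans[OF abs_ge_self])
        then show False using d(1) by (simp add: field_simps)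
      qed
      then have "exp (- Q / s\<^sup>2) \<le> measure (cscg_entries m' n' s) ?E'"
        by (intro lower[rule_format] meas) auto
      moreover have "r - c \<le> frob m n \<omega>" if "\<not> ?B m n c \<omega>" for \<omega>
      proof (rule ccontr)
        assume "\<not> r - c \<le> frob m n \<omega>"
        moreover have "bilinear_bound m n (\<bar>c\<bar> + frob m n \<omega>) (\<lambda>ij. corner c ij + \<omega> ij)"
          using bilinear_bound_frob[of m n "corner c"] pos
          by (intro bilinear_bound_add bilinear_bound_frob) (simp add: frob_corner)
        ultimately show False using that c by (auto dest: bilinear_bound_mono[where r' = r])
      qed
      then have "measure (cscg_entries m n s) ?E \<le> exp (- Q / s\<^sup>2)"
        by (intro upper[rule_format] meas) auto
      ultimately have "measure (cscg_entries m n s) ?E \<le> measure (cscg_entries m' n' s) ?E'"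
        by simp
      then show "offset_prob m' n' s r (corner c') \<le> offset_prob m n s r (corner c)"
        using prob_space.prob_neg[OF prob_space_cscg_entries[OF s]] sets_bilinear_bound
        by (simp add: offset_prob_def)
    qed
  qed
qed

section \<open>From the channel parameters to a normalised problem\<close>

lemma bilinear_bound_mult_pos:
  assumes "b > 0"
  shows "bilinear_bound m n (b * r) (\<lambda>ij. complex_of_real b * M ij) \<longleftrightarrow> bilinear_bound m n r M"
proof -
  have "(\<Sum>i<m. \<Sum>j<n. x i * (complex_of_real b * M (i, j)) * y j)
      = complex_of_real b * (\<Sum>i<m. \<Sum>j<n. x i * M (i, j) * y j)" for x y
    by (simp add: sum_distrib_left mult_ac)
  then show ?thesis using assms by (simp add: bilinear_bound_def norm_mult mult.assoc)
qed

text \<open>Outage means that the operator norm of \<open>H\<close> is at most sqrt t with t =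
  mu_min * sigma_n^2 / Omega_D. Dividing by sqrt (1 / (K + 1)) gives the noise weight 1, the mean
  sqrt K * u v^dagger and the radius sqrt (t * (K + 1)). The trace condition fixes |u| * |v|, so
  \<open>u\<close> and \<open>v\<close> disappear from the right-hand side.\<close>

lemma P_out_eq_offset_prob:
  assumes pos: "K > 0" "\<sigma>n > 0" "\<Omega>D > 0" "\<mu>min > 0" "s > 0" "nT > 0" "nR > 0"
    and uv: "normalized_pair nT nR u v"
  shows "P_out K \<sigma>n \<Omega>D \<mu>min s nT nR u v
    = offset_prob nR nT s (sqrt (\<mu>min * \<sigma>n\<^sup>2 / \<Omega>D * (K + 1))) (corner (sqrt (K * real (nR * nT))))"
proof -
  define t where "t = \<mu>min * \<sigma>n\<^sup>2 / \<Omega>D"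
  have t: "t > 0" using pos by (simp add: t_def)
  define a where "a = sqrt (K / (K + 1))"
  define b where "b = sqrt (1 / (K + 1))"
  have b: "b > 0" "sqrt K * b = a" "sqrt (K + 1) * b = 1"
    using pos by (simp_all add: a_def b_def flip: real_sqrt_mult)
  have u: "u \<in> carrier_vec nR" and v: "v \<in> carrier_vec nT"
    and tr: "mat_trace (rank_one_mat u v * mat_adjoint (rank_one_mat u v)) = of_nat (nR * nT)"
    using uv by (auto simp: normalized_pair_def)
  let ?U = "L2_set (\<lambda>i. cmod (u $ i)) {..<nR}" and ?V = "L2_set (\<lambda>j. cmod (v $ j)) {..<nT}"
  have "complex_of_real (?U\<^sup>2 * ?V\<^sup>2) = of_nat (nR * nT)"
  proof -
    have "mat_trace (rank_one_mat u v * mat_adjoint (rank_one_mat u v))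
        = (\<Sum>i<nR. \<Sum>j<nT. (u $ i * cnj (u $ i)) * (v $ j * cnj (v $ j)))"
      using u v by (simp add: mat_trace_def rank_one_mat_def scalar_prod_def atLeast0LessThan mult_ac)
    also have "\<dots> = (\<Sum>i<nR. u $ i * cnj (u $ i)) * (\<Sum>j<nT. v $ j * cnj (v $ j))"
      by (simp add: sum_product)
    also have "\<dots> = complex_of_real (?U\<^sup>2 * ?V\<^sup>2)"
      by (simp add: L2_set_def sum_nonneg complex_norm_square del: of_real_power)
    finally show ?thesis using tr by simp
  qed
  then have "(?U * ?V)\<^sup>2 = real (nR * nT)"
    unfolding power_mult_distrib by (metis of_real_eq_iff of_real_of_nat_eq)
  then have "sqrt ((?U * ?V)\<^sup>2) = sqrt (real (nR * nT))" by (rule arg_cong)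
  then have "?U * ?V = sqrt (real (nR * nT))" by (simp add: L2_set_nonneg)
  then have UV: "sqrt K * ?U * ?V = sqrt (K * real (nR * nT))"
    by (simp add: real_sqrt_mult mult.assoc)
  have scale: "\<Omega>D / \<sigma>n\<^sup>2 * x \<le> \<mu>min \<longleftrightarrow> x \<le> t" for x
    using pos by (simp add: t_def field_simps)
  have event: "snr \<Omega>D \<sigma>n (rician_mat K (rank_one_mat u v) (mat nR nT \<omega>)) \<le> \<mu>min \<longleftrightarrow>
      bilinear_bound nR nT (sqrt (t * (K + 1))) (\<lambda>ij. (case ij of (i, j) \<Rightarrow> (sqrt K * u $ i) * cnj (v $ j)) + \<omega> ij)"
    for \<omega>
  proof -
    let ?H = "rician_mat K (rank_one_mat u v) (mat nR nT \<omega>)"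
    have H: "?H \<in> carrier_mat nR nT"
      using u v by (simp add: rician_mat_def rank_one_mat_def)
    have entry: "?H $$ (i, j) = complex_of_real a * (u $ i * cnj (v $ j)) + complex_of_real b * \<omega> (i, j)"
      if "i < nR" "j < nT" for i j
      using u v that by (simp add: rician_mat_def rank_one_mat_def a_def b_def)
    have ab: "complex_of_real a = complex_of_real (sqrt K) * complex_of_real b"
      by (simp flip: b(2))
    have "snr \<Omega>D \<sigma>n ?H \<le> \<mu>min \<longleftrightarrow> max_eigenvalue (?H * mat_adjoint ?H) \<le> t"
      unfolding snr_def by (rule scale)
    also have "\<dots> \<longleftrightarrow> bilinear_bound nR nT (sqrt t) (\<lambda>ij. ?H $$ ij)"
      using max_eigenvalue_le_iff[OF H] pos t by simp
    also have "\<dots> \<longleftrightarrow> bilinear_bound nR nT (sqrt t)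
        (\<lambda>ij. complex_of_real b * ((case ij of (i, j) \<Rightarrow> (sqrt K * u $ i) * cnj (v $ j)) + \<omega> ij))"
      by (intro bilinear_bound_cong) (simp add: entry ab algebra_simps)
    also have "\<dots> \<longleftrightarrow> bilinear_bound nR nT (sqrt (t * (K + 1)))
        (\<lambda>ij. (case ij of (i, j) \<Rightarrow> (sqrt K * u $ i) * cnj (v $ j)) + \<omega> ij)"
    proof -
      have "sqrt t = b * sqrt (t * (K + 1))" using b(3) by (simp add: real_sqrt_mult mult_ac)
      then show ?thesis using bilinear_bound_mult_pos[OF b(1)] by simp
    qed
    finally show ?thesis .
  qed
  have "P_out K \<sigma>n \<Omega>D \<mu>min s nT nR u v
      = offset_prob nR nT s (sqrt (t * (K + 1))) (\<lambda>(i, j). (sqrt K * u $ i) * cnj (v $ j))"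
    by (simp add: P_out_def offset_prob_def event)
  also have "\<dots> = offset_prob nR nT s (sqrt (t * (K + 1))) (corner (sqrt K * ?U * ?V))"
    using pos by (subst offset_prob_rank_one) (auto simp: norm_mult L2_set_right_distrib)
  finally show ?thesis by (simp add: UV t_def)
qed

text \<open>With \<open>d\<close> the offset of \<open>a\<close> from k = N div 2, the product is
  k^2 - d^2 for even \<open>N\<close> and k * (k + 1) - d * (d - 1) for odd \<open>N\<close>. In the
  odd case d = 0 and d = 1 are the two balanced pairs, and d * (d - 1) is positive for every other
  integer.\<close>

lemma mult_less_balanced:
  fixes a b :: nat
  assumes "a + b = N"
  shows "even N \<Longrightarrow> a \<noteq> N div 2 \<Longrightarrow> a * b < (N div 2) * (N div 2)"
    and "odd N \<Longrightarrow> a \<noteq> N div 2 \<Longrightarrow> b \<noteq> N div 2 \<Longrightarrow> a * b < (N div 2) * (N div 2 + 1)"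
proof -
  assume "even N" and ne: "a \<noteq> N div 2"
  then obtain k where N: "N = 2 * k" by (elim evenE)
  define d where "d = int a - int k"
  have ab: "int a = k + d" "int b = k - d" using assms N by (auto simp: d_def)
  have "d \<noteq> 0" using ne N by (auto simp: d_def)
  then have "int a * int b < int k * int k"
    unfolding ab by (simp add: algebra_simps not_sum_squares_lt_zero flip: power2_eq_square)
  then show "a * b < (N div 2) * (N div 2)" using N by (simp flip: of_nat_mult)
next
  assume "odd N" and ne: "a \<noteq> N div 2" "b \<noteq> N div 2"
  then obtain k where N: "N = 2 * k + 1" by (elim oddE)
  define d where "d = int a - int k"
  have ab: "int a = k + d" "int b = k + 1 - d" using assms N by (auto simp: d_def)
  have "d < 0 \<or> d > 1" using ne N assms by (auto simp: d_def)
  then have "0 < d * (d - 1)" by (auto simp: zero_less_mult_iff)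
  then have "int a * int b < int k * (int k + 1)"
    unfolding ab by (simp add: algebra_simps)
  then have "int (a * b) < int (k * (k + 1))"
    by (simp only: of_nat_mult of_nat_add of_nat_1)
  then have "a * b < k * (k + 1)" by (simp only: of_nat_less_iff)
  then show "a * b < (N div 2) * (N div 2 + 1)" using N by simp
qed

text \<open>The vectors are quantified after \<open>\<sigma>H\<close>, so the smallness threshold is
  uniform in them. Minimality is non-strict, as it has to be for odd \<open>N\<close>, where the two
  balanced pairs have the same outage probability.\<close>

theorem claim1:
  fixes N :: nat and K \<sigma>n \<Omega>D \<mu>min :: real
  assumes "N \<ge> 2" and "K > 0" and "\<sigma>n > 0" and "\<Omega>D > 0" and "\<mu>min > 0"
  shows "\<forall>\<^sub>F \<sigma>H in at_right 0.
    \<forall>u v :: nat \<Rightarrow> nat \<Rightarrow> complex vec.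
      (\<forall>nT nR. nT > 0 \<and> nR > 0 \<and> nT + nR = N \<longrightarrow> normalized_pair nT nR (u nT nR) (v nT nR)) \<longrightarrow>
      (let minimizer = is_arg_min
             (\<lambda>(nT, nR). P_out K \<sigma>n \<Omega>D \<mu>min \<sigma>H nT nR (u nT nR) (v nT nR))
             (\<lambda>(nT, nR). nT > 0 \<and> nR > 0 \<and> nT + nR = N)
       in (even N \<longrightarrow> minimizer (N div 2, N div 2)) \<and>
          (odd N \<longrightarrow> minimizer (nat \<lfloor>real N / 2\<rfloor>, nat \<lceil>real N / 2\<rceil>)))"
proof -
  define r where "r = sqrt (\<mu>min * \<sigma>n\<^sup>2 / \<Omega>D * (K + 1))"
  have r: "r > 0" using assms by (simp add: r_def)
  \<comment> \<open>Rows come first: \<open>m\<close> counts receiving and \<open>n\<close>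
    transmitting antennas, so the claimed optimum has the value
    \<open>P s (N - k) k\<close>.\<close>
  define P where "P s m n = offset_prob m n s r (corner (sqrt (K * real (m * n))))" for s m n
  define k where "k = N div 2"
  have k: "k > 0" "N - k > 0" using assms(1) by (auto simp: k_def)
  \<comment> \<open>Only strictly smaller products are compared asymptotically; there are finitely
    many pairs, so the thresholds for the individual pairs have a common one.\<close>
  have "\<forall>\<^sub>F s in at_right 0. \<forall>m\<in>{..N}. \<forall>n\<in>{..N}.
      0 < m \<and> 0 < n \<and> m * n < k * (N - k) \<longrightarrow> P s (N - k) k \<le> P s m n"
  proof (intro eventually_ball_finite ballI)
    fix m n
    show "\<forall>\<^sub>F s in at_right 0. 0 < m \<and> 0 < n \<and> m * n < k * (N - k) \<longrightarrow> P s (N - k) k \<le> P s m n"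
    proof (cases "0 < m \<and> 0 < n \<and> m * n < k * (N - k)")
      case True
      then have "real (m * n) < real ((N - k) * k)"
        unfolding of_nat_less_iff by (simp add: mult.commute)
      then have "sqrt (K * real (m * n)) < sqrt (K * real ((N - k) * k))"
        using assms(2) by simp
      then show ?thesis
        using True k r assms(2) eventually_offset_prob_corner_le[of m n "N - k" k r] by (simp add: P_def)
    next
      case False
      then show ?thesis by (intro always_eventually) auto
    qed
  qed simp_all
  moreover have "\<forall>\<^sub>F s :: real in at_right 0. s > 0" by (rule eventually_at_right_less)
  ultimately show ?thesis
  proof eventually_elim
    fix s :: real
    assume cmp: "\<forall>m\<in>{..N}. \<forall>n\<in>{..N}. 0 < m \<and> 0 < n \<and> m * n < k * (N - k) \<longrightarrow> P s (N - k) k \<le> P s m n"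
      and s: "0 < s"
    have le: "P s (N - k) k \<le> P s nR nT" if "0 < nT" "0 < nR" "nT + nR = N" for nT nR
    proof (cases "nR * nT < k * (N - k)")
      case True
      then show ?thesis using cmp that by auto
    next
      case False
      \<comment> \<open>A product that is not strictly smaller forces a balanced pair: either the
        claimed one or its mirror image, which has the same value for every positive
        \<open>s\<close> by transposition.\<close>
      have "nT = k \<or> nR = k"
      proof (rule ccontr)
        assume ne: "\<not> (nT = k \<or> nR = k)"
        have "nT * nR < k * (N - k)"
        proof (cases "even N")
          case True
          then have "N - k = k" by (auto simp: k_def)
          then show ?thesis using mult_less_balanced(1)[OF that(3) True] ne by (simp add: k_def)
        next
          case False
          then have "N - k = k + 1" unfolding k_def by presburger
          then show ?thesis using mult_less_balanced(2)[OF that(3) False] ne by (simp add: k_def)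
        qed
        then show False using False by (simp add: mult.commute)
      qed
      then show ?thesis
      proof
        assume "nT = k"
        moreover have "nR = N - k" using that calculation by simp
        ultimately show ?thesis by simp
      next
        assume "nR = k"
        moreover have "nT = N - k" using that calculation by simp
        moreover have "P s k (N - k) = P s (N - k) k"
        proof -
          have "(\<lambda>(j, i). corner c (i, j)) = corner c" for c
            by (auto simp: corner_def)
          then show ?thesis
            using offset_prob_transpose[OF s, of k "N - k" r "corner (sqrt (K * real ((N - k) * k)))"]
            by (simp add: P_def mult.commute)
        qed
        ultimately show ?thesis by simp
      qed
    qed
    show "\<forall>u v :: nat \<Rightarrow> nat \<Rightarrow> complex vec.
      (\<forall>nT nR. nT > 0 \<and> nR > 0 \<and> nT + nR = N \<longrightarrow> normalized_pair nT nR (u nT nR) (v nT nR)) \<longrightarrow>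
      (let minimizer = is_arg_min
             (\<lambda>(nT, nR). P_out K \<sigma>n \<Omega>D \<mu>min s nT nR (u nT nR) (v nT nR))
             (\<lambda>(nT, nR). nT > 0 \<and> nR > 0 \<and> nT + nR = N)
       in (even N \<longrightarrow> minimizer (N div 2, N div 2)) \<and>
          (odd N \<longrightarrow> minimizer (nat \<lfloor>real N / 2\<rfloor>, nat \<lceil>real N / 2\<rceil>)))"
    proof (intro allI impI)
      fix u v :: "nat \<Rightarrow> nat \<Rightarrow> complex vec"
      assume norm: "\<forall>nT nR. nT > 0 \<and> nR > 0 \<and> nT + nR = N \<longrightarrow> normalized_pair nT nR (u nT nR) (v nT nR)"
      let ?F = "\<lambda>(nT, nR). P_out K \<sigma>n \<Omega>D \<mu>min s nT nR (u nT nR) (v nT nR)"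
      let ?D = "\<lambda>(nT :: nat, nR :: nat). nT > 0 \<and> nR > 0 \<and> nT + nR = N"
      have F: "?F (nT, nR) = P s nR nT" if "0 < nT" "0 < nR" "nT + nR = N" for nT nR
        using P_out_eq_offset_prob[OF assms(2-5) s that(1,2)] norm that by (simp add: P_def r_def)
      have kN: "0 < k" "0 < N - k" "k + (N - k) = N" using k by auto
      have least: "?F (k, N - k) \<le> ?F y" if "?D y" for y
      proof -
        obtain nT nR where y: "y = (nT, nR)" by fastforce
        then have "0 < nT" "0 < nR" "nT + nR = N" using that by auto
        then show ?thesis unfolding y F[OF kN] using le F by simp
      qed
      have "?D (k, N - k)" using kN by simp
      then have min: "is_arg_min ?F ?D (k, N - k)"
        unfolding is_arg_min_def using leD[OF least] by blast
      have even: "(N div 2, N div 2) = (k, N - k)" if "even N" using that by (auto simp: k_def)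
      have odd: "(nat \<lfloor>real N / 2\<rfloor>, nat \<lceil>real N / 2\<rceil>) = (k, N - k)" if "odd N"
      proof -
        obtain j where j: "N = 2 * j + 1" using \<open>odd N\<close> by (elim oddE)
        have "\<lfloor>real N / 2\<rfloor> = int j" "\<lceil>real N / 2\<rceil> = int j + 1"
          unfolding j by (simp_all add: floor_eq_iff ceiling_eq_iff field_simps)
        then show ?thesis using j by (simp add: k_def)
      qed
      have "is_arg_min ?F ?D (N div 2, N div 2)" if "even N"
        unfolding even[OF that] by (rule min)
      moreover have "is_arg_min ?F ?D (nat \<lfloor>real N / 2\<rfloor>, nat \<lceil>real N / 2\<rceil>)" if "odd N"
        unfolding odd[OF that] by (rule min)
      ultimately show "let minimizer = is_arg_min ?F ?D
       in (even N \<longrightarrow> minimizer (N div 2, N div 2)) \<and>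
          (odd N \<longrightarrow> minimizer (nat \<lfloor>real N / 2\<rfloor>, nat \<lceil>real N / 2\<rceil>))"
        unfolding Let_def by blast
    qed
  qed
qed

end
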